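(* Let $A\in\mathbb{C}^{n\times n}$, $B\in\mathbb{C}^{n\times m}$, $C\in\mathbb{C}^{p\times n}$, $D\in\mathbb{C}^{p\times m}$ and $F\in\mathbb{C}^{\nu\times\nu}$, and suppose $\mathrm{eig}(A)\cap\mathrm{eig}(F)=\emptyset$. The following statements are equivalent: (i) $\mathcal{R}_\Sigma(\lambda)$ has full row rank $n+p$ for all $\lambda\in\mathrm{eig}(F)$; (ii) for every pair $(P,Q)\in\mathbb{C}^{n\times\nu}\times\mathbb{C}^{p\times\nu}$, the system of equations $$\Pi F = A\Pi + B\Psi + P,\qquad 0 = C\Pi + D\Psi + Q$$ admits a solution $(\Pi,\Psi)\in\mathbb{C}^{n\times\nu}\times\mathbb{C}^{m\times\nu}$; (iii) for every pair $(\bar P,\bar Q)\in\mathbb{C}^{\nu\times n}\times\mathbb{C}^{\nu\times m}$ for which the system of equations $$MA = FM + GC + \bar P,\qquad 0 = -MB + GD + \bar Q$$ admits a solution $(M,G)\in\mathbb{C}^{\nu\times n}\times\mathbb{C}^{\nu\times p}$, this solution is unique; (iv) the linear map $\mathcal{C}_{\rm p}:\mathbb{C}^{m\times\nu}\to\mathbb{C}^{p\times\nu}$ is surjective; (v) the linear map $\mathcal{C}_{\rm d}:\mathbb{C}^{\nu\times p}\to\mathbb{C}^{\nu\times m}$ is injective. Moreover, for any $G\in\mathbb{C}^{\nu\times p}$: (a) if $(F,G)$ is controllable and (i) holds, then $(F,\mathcal{C}_{\rm d}(G))$ is controllable; (b) if $(F,G)$ is stabilizable and $\mathcal{R}_\Sigma(\lambda)$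 has full row rank for all $\lambda\in\mathrm{eig}(F)\cap\mathbb{C}_{\geq 0}$, then $(F,\mathcal{C}_{\rm d}(G))$ is stabilizable. Furthermore, the converse of (a) holds (i.e., $(F,\mathcal{C}_{\rm d}(G))$ controllable implies $(F,G)$ controllable and (i)) provided $G^{\sf T}\ker(\lambda I_\nu - F^{\sf T})=\mathbb{C}^p$ for all $\lambda\in\mathrm{eig}(F)$; and the converse of (b) holds (i.e., $(F,\mathcal{C}_{\rm d}(G))$ stabilizable implies $(F,G)$ stabilizable and $\mathcal{R}_\Sigma(\lambda)$ has full row rank for all $\lambda\in\mathrm{eig}(F)\cap\mathbb{C}_{\ge 0}$) provided $G^{\sf T}\ker(\lambda I_\nu - F^{\sf T})=\mathbb{C}^p$ for all $\lambda\in\mathrm{eig}(F)\cap\mathbb{C}_{\geq 0}$.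
   Context: Data: $A\in\mathbb{C}^{n\times n}$, $B\in\mathbb{C}^{n\times m}$, $C\in\mathbb{C}^{p\times n}$, $D\in\mathbb{C}^{p\times m}$, $F\in\mathbb{C}^{\nu\times\nu}$, with $\mathrm{eig}(A)\cap\mathrm{eig}(F)=\emptyset$. The Rosenbrock system matrix is $\mathcal{R}_\Sigma(\lambda)=\begin{bmatrix}A-\lambda I_n & B\\ C & D\end{bmatrix}\in\mathbb{C}^{(n+p)\times(n+m)}$ for $\lambda\in\mathbb{C}$. The steady-state cascade (SSC) operators are defined as follows: for $H\in\mathbb{C}^{m\times\nu}$, $\mathcal{C}_{\rm p}(H)=C\Pi+DH$, where $\Pi\in\mathbb{C}^{n\times\nu}$ is the unique solution of the Sylvester equation $\Pi F - A\Pi = BH$; for $G\in\mathbb{C}^{\nu\times p}$, $\mathcal{C}_{\rm d}(G)=-MB+GD$, where $M\in\mathbb{C}^{\nu\times n}$ is the unique solution of $MA-FM=GC$. $\mathbb{C}_{\geq 0}$ is the set of complex numbers with nonnegative real part. For a matrix $G$ and subspace $\mathcal{V}$, $G^{\sf T}\mathcal{V}=\{G^{\sf T}v: v\in\mathcal{V}\}$. A pair $(F,G)$ is stabilizable if every eigenvalue $\lambda$ of $F$ with $\mathrm{Re}\,\lambda\ge 0$ is controllable, i.e., $\varphi^{\sf T}G\neq 0$ for every nonzero $\varphi$ with $\varphi^{\sf T}F=\lambda\varphi^{\sf T}$. *)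

theory Defs
  imports "Jordan_Normal_Form.DL_Rank_Submatrix" "Jordan_Normal_Form.Char_Poly" "Jordan_Normal_Form.Matrix_Kernel" "HOL-Analysis.Analysis"
begin

definition eig :: "complex mat \<Rightarrow> complex set" where
  "eig A = {z. eigenvalue A z}"

definition rosenbrock :: "complex mat \<Rightarrow> complex mat \<Rightarrow> complex mat \<Rightarrow> complex mat \<Rightarrow> complex \<Rightarrow> complex mat" where
  "rosenbrock A B C D s = four_block_mat (A - s \<cdot>\<^sub>m 1\<^sub>m (dim_row A)) B C D"

definition full_row_rank :: "complex mat \<Rightarrow> bool" where
  "full_row_rank M \<longleftrightarrow> vec_space.rank (dim_row M) M = dim_row M"

definition Cp :: "complex mat \<Rightarrow> complex mat \<Rightarrow> complex mat \<Rightarrow> complex mat \<Rightarrow> complex mat \<Rightarrow> complex mat \<Rightarrow> complex mat" where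
  "Cp A B C D F H =
     (let PI = (THE PI. PI \<in> carrier_mat (dim_row A) (dim_row F) \<and> PI * F - A * PI = B * H)
      in C * PI + D * H)"

definition Cd :: "complex mat \<Rightarrow> complex mat \<Rightarrow> complex mat \<Rightarrow> complex mat \<Rightarrow> complex mat \<Rightarrow> complex mat \<Rightarrow> complex mat" where
  "Cd A B C D F G =
     (let M = (THE M. M \<in> carrier_mat (dim_row F) (dim_row A) \<and> M * A - F * M = G * C)
      in - (M * B) + G * D)"

text \<open>Controllability of (F,G) (Hautus/PBH form): every left eigenvector \<phi> of F
  (\<phi>^T F = s \<phi>^T, \<phi> \<noteq> 0) satisfies \<phi>^T G \<noteq> 0.\<close>
definition controllable :: "complex mat \<Rightarrow> complex mat \<Rightarrow> bool" where
  "controllable F G \<longleftrightarrow>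
     (\<forall>s \<in> eig F. \<forall>\<phi> \<in> carrier_vec (dim_row F).
        \<phi> \<noteq> 0\<^sub>v (dim_row F) \<and> transpose_mat F *\<^sub>v \<phi> = s \<cdot>\<^sub>v \<phi> \<longrightarrow> transpose_mat G *\<^sub>v \<phi> \<noteq> 0\<^sub>v (dim_col G))"

definition stabilizable :: "complex mat \<Rightarrow> complex mat \<Rightarrow> bool" where
  "stabilizable F G \<longleftrightarrow>
     (\<forall>s \<in> eig F. Re s \<ge> 0 \<longrightarrow> (\<forall>\<phi> \<in> carrier_vec (dim_row F).
        \<phi> \<noteq> 0\<^sub>v (dim_row F) \<and> transpose_mat F *\<^sub>v \<phi> = s \<cdot>\<^sub>v \<phi> \<longrightarrow> transpose_mat G *\<^sub>v \<phi> \<noteq> 0\<^sub>v (dim_col G)))"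

end

theory Submission
  imports Defs "Jordan_Normal_Form.Schur_Decomposition"
begin

text \<open>
  A Schur decomposition \<open>F = S U S\<inverse>\<close> turns the primal equations into a system that is solved column
  by column, the \<open>k\<close>-th column requiring only that the system matrix at the eigenvalue \<open>U\<^sub>k\<^sub>k\<close> is onto;
  this gives (i) \<open>\<Longrightarrow>\<close> (ii), and for \<open>m = p = 0\<close> the solvability of Sylvester equations. The primal and
  the dual map are adjoint for the pairing \<open>(X, Y) \<mapsto> tr (X Y)\<close>, so that surjectivity of the former
  forces injectivity of the latter. Conversely, a left null vector \<open>(w, v)\<close> of the system matrix at an
  eigenvalue of \<open>F\<close> with eigenvector \<open>x\<close> yields the homogeneous dual solution \<open>(x w\<^sup>T, -x v\<^sup>T)\<close>. For the
  controllability statements, a left eigenvector \<open>\<phi>\<close> of \<open>F\<close> corresponds to \<open>(-M\<^sup>T\<phi>, G\<^sup>T\<phi>)\<close>, on which the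
  transposed system matrix takes the value \<open>(0, C\<^sub>d(G)\<^sup>T\<phi>)\<close>.
\<close>

unbundle no vec_syntax and no inner_syntax
hide_const (open) Finite_Cartesian_Product.vec Finite_Cartesian_Product.mat Determinants.det
hide_type (open) Finite_Cartesian_Product.vec
hide_fact (open) Determinants.det_transpose

subsection \<open>Full row rank\<close>

text \<open>Moving M across the Hermitian form turns the squared norm of M w into the product of the
  conjugate of w with the adjoint of M applied to M w. This is 0, and the form is definite.\<close>

lemma mult_mat_vec_eq_0_if_adjoint:
  fixes M :: "complex mat"
  assumes M: "M \<in> carrier_mat nr nc" and w: "w \<in> carrier_vec nc"
    and eq: "mat_adjoint M *\<^sub>v (M *\<^sub>v w) = 0\<^sub>v nc"
  shows "M *\<^sub>v w = 0\<^sub>v nr"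
proof -
  have N: "mat_adjoint M = (map_mat conjugate M)\<^sup>T"
    using M by (intro eq_matI) (auto simp: mat_adjoint_def mat_of_rows_def)
  have cM: "map_mat conjugate M \<in> carrier_mat nr nc" using M by auto
  have Mw: "M *\<^sub>v w \<in> carrier_vec nr" using M w by auto
  have cMw: "conjugate (M *\<^sub>v w) = map_mat conjugate M *\<^sub>v conjugate w"
    using M w by (intro eq_vecI) (auto simp: scalar_prod_def sum_conjugate conjugate_dist_mul)
  have "(M *\<^sub>v w) \<bullet>c (M *\<^sub>v w) = (map_mat conjugate M *\<^sub>v conjugate w) \<bullet> (M *\<^sub>v w)"
    unfolding cMw[symmetric] using Mw by (intro comm_scalar_prod[of _ nr]) auto
  also have "\<dots> = conjugate w \<bullet> (mat_adjoint M *\<^sub>v (M *\<^sub>v w))"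
    unfolding N 
    using transpose_vec_mult_scalar[of "map_mat conjugate M" nr nc "conjugate w" "M *\<^sub>v w"] M w cM Mw cMw
    by (metis carrier_vec_conjugate comm_scalar_prod mult_mat_vec_carrier transpose_carrier_mat)
  also have "\<dots> = 0" unfolding eq using w by auto
  finally show ?thesis using Mw conjugate_square_eq_0_vec[OF Mw] by auto
qed

text \<open>For K = M^T the Gram matrix \<open>mat_adjoint K * K\<close> has the same kernel as K,
  hence is invertible. Its transpose factors with M on the left, so inverting it gives an explicit
  right inverse of M.\<close>

lemma surj_if_trivial_left_kernel:
  fixes M :: "complex mat"
  assumes M: "M \<in> carrier_mat nr nc"
    and ker: "\<And>w. w \<in> carrier_vec nr \<Longrightarrow> M\<^sup>T *\<^sub>v w = 0\<^sub>v nc \<Longrightarrow> w = 0\<^sub>v nr"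
    and b: "b \<in> carrier_vec nr"
  shows "\<exists>x\<in>carrier_vec nc. M *\<^sub>v x = b"
proof -
  define K where "K = M\<^sup>T"
  define S where "S = mat_adjoint K * K"
  have K: "K \<in> carrier_mat nc nr" and aK: "mat_adjoint K \<in> carrier_mat nr nc"
    using M by (auto simp: K_def mat_adjoint_def)
  have S: "S \<in> carrier_mat nr nr" using K aK by (auto simp: S_def)
  have "det S \<noteq> 0"
  proof
    assume "det S = 0"
    then obtain w where w: "w \<in> carrier_vec nr" "w \<noteq> 0\<^sub>v nr" "S *\<^sub>v w = 0\<^sub>v nr"
      using det_0_iff_vec_prod_zero_field[OF S] by blast
    have "mat_adjoint K *\<^sub>v (K *\<^sub>v w) = 0\<^sub>v nr"
      using w(3) assoc_mult_mat_vec[OF aK K w(1)] by (simp add: S_def)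
    from mult_mat_vec_eq_0_if_adjoint[OF K w(1) this] ker[OF w(1)] w(2) show False by (simp add: K_def)
  qed
  then have "det S\<^sup>T \<noteq> 0" using det_transpose[OF S] by simp
  from det_non_zero_imp_unit[OF _ this, of nr] S
  obtain T where T: "T \<in> carrier_mat nr nr" "S\<^sup>T * T = 1\<^sub>m nr"
    by (auto simp: Units_def ring_mat_def)
  have ST: "S\<^sup>T = M * (mat_adjoint K)\<^sup>T"
    unfolding S_def using transpose_mult[OF aK K] by (simp add: K_def)
  let ?x = "(mat_adjoint K)\<^sup>T *\<^sub>v (T *\<^sub>v b)"
  have Tb: "T *\<^sub>v b \<in> carrier_vec nr" using T b by auto
  have "M *\<^sub>v ?x = S\<^sup>T *\<^sub>v (T *\<^sub>v b)"
    unfolding ST by (rule assoc_mult_mat_vec[symmetric]) (use M aK Tb in auto)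
  also have "\<dots> = b" using assoc_mult_mat_vec[of "S\<^sup>T" nr nr T nr b] S T b by simp
  finally show ?thesis using aK Tb by (intro bexI[of _ ?x]) auto
qed

text \<open>Write the conjugate of w as M x. The squared norm of w is then the product of M^T w = 0
  with x.\<close>

lemma trivial_left_kernel_if_surj:
  fixes M :: "complex mat"
  assumes M: "M \<in> carrier_mat nr nc"
    and surj: "\<And>b. b \<in> carrier_vec nr \<Longrightarrow> \<exists>x\<in>carrier_vec nc. M *\<^sub>v x = b"
    and w: "w \<in> carrier_vec nr" and eq: "M\<^sup>T *\<^sub>v w = 0\<^sub>v nc"
  shows "w = 0\<^sub>v nr"
proof -
  obtain x where x: "x \<in> carrier_vec nc" "M *\<^sub>v x = conjugate w" using surj[of "conjugate w"] w by auto
  have "w \<bullet>c w = (M\<^sup>T *\<^sub>v w) \<bullet> x"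
    using transpose_vec_mult_scalar[OF M x(1) w] x w M
    by (metis comm_scalar_prod carrier_vec_conjugate mult_mat_vec_carrier transpose_carrier_mat)
  then show ?thesis using eq x w by simp
qed

text \<open>The rank is the dimension of the column span, which is the set of all products M x. It
  remains to see that a span of dimension \<open>nr\<close> is the whole space.\<close>

lemma full_row_rank_iff_surj:
  assumes M: "M \<in> carrier_mat nr nc"
  shows "full_row_rank M \<longleftrightarrow> (\<forall>b\<in>carrier_vec nr. \<exists>x\<in>carrier_vec nc. M *\<^sub>v x = b)"
proof -
  interpret vec_space "TYPE(complex)" nr .
  have cols: "set (cols M) \<subseteq> carrier_vec nr" using M cols_dim[of M] by auto
  have rank: "full_row_rank M \<longleftrightarrow> vectorspace.dim class_ring (span_vs (set (cols M))) = nr"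
    using M by (auto simp: full_row_rank_def rank_def)
  have "span (set (cols M)) = carrier_vec nr \<longleftrightarrow> (\<forall>b\<in>carrier_vec nr. \<exists>x\<in>carrier_vec nc. M *\<^sub>v x = b)"
    using col_space_eq[OF M] M by (auto simp: col_space_def)
  moreover have "vectorspace.dim class_ring (span_vs (set (cols M))) = nr \<longleftrightarrow> span (set (cols M)) = carrier_vec nr"
  proof
    \<comment> \<open>A maximal independent set of columns has as many elements as the dimension of
      the span, and \<open>nr\<close> independent vectors form a basis of the whole space.\<close>
    assume dim: "vectorspace.dim class_ring (span_vs (set (cols M))) = nr"
    obtain U where U: "maximal U (\<lambda>T. T \<subseteq> set (cols M) \<and> lin_indpt T)"
      using maximal_exists_superset[of "set (cols M)" "\<lambda>T. T \<subseteq> set (cols M) \<and> lin_indpt T" "{}"]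
      by (auto simp: lin_dep_def)
    then have U': "U \<subseteq> set (cols M)" "lin_indpt U" by (auto simp: maximal_def)
    have "card U = nr" using dim_span[OF _ _ U] cols dim by auto
    then have "basis U" using U' cols finite_subset[OF U'(1)] by (intro dim_li_is_basis) (auto simp: dim_is_n)
    then show "span (set (cols M)) = carrier_vec nr"
      using span_is_monotone[OF U'(1)] span_is_subset2[of "set (cols M)"] cols by (auto simp: basis_def)
  next
    assume "span (set (cols M)) = carrier_vec nr"
    then show "vectorspace.dim class_ring (span_vs (set (cols M))) = nr" using dim_is_n by (simp add: module_vec_def)
  qed
  ultimately show ?thesis using rank by simp
qed

lemma full_row_rank_iff_left_kernel:
  assumes M: "M \<in> carrier_mat nr nc"
  shows "full_row_rank M \<longleftrightarrow> (\<forall>w\<in>carrier_vec nr. M\<^sup>T *\<^sub>v w = 0\<^sub>v nc \<longrightarrow> w = 0\<^sub>v nr)"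
  unfolding full_row_rank_iff_surj[OF M]
  using surj_if_trivial_left_kernel[OF M] trivial_left_kernel_if_surj[OF M] by blast

subsection \<open>The Rosenbrock system matrix\<close>

lemma shifted_mat_mult_vec:
  fixes A :: "'a :: comm_ring_1 mat"
  assumes A: "A \<in> carrier_mat n n" and x: "x \<in> carrier_vec n"
  shows "(A - s \<cdot>\<^sub>m 1\<^sub>m n) *\<^sub>v x = A *\<^sub>v x - s \<cdot>\<^sub>v x"
proof -
  have "(s \<cdot>\<^sub>m 1\<^sub>m n) *\<^sub>v x = s \<cdot>\<^sub>v x"
    using x by (intro eq_vecI) (auto simp: smult_scalar_prod_distrib[of _ n])
  then show ?thesis using minus_mult_distrib_mat_vec[OF A _ x, of "s \<cdot>\<^sub>m 1\<^sub>m n"] by simp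
qed

lemma rosenbrock_carrier:
  assumes "A \<in> carrier_mat n n" "B \<in> carrier_mat n m" "C \<in> carrier_mat p n" "D \<in> carrier_mat p m"
  shows "rosenbrock A B C D s \<in> carrier_mat (n + p) (n + m)"
  using assms unfolding rosenbrock_def by (intro four_block_carrier_mat) auto

text \<open>The rank condition in the form needed to determine a single column of the primal
  unknowns.\<close>

lemma full_row_rank_rosenbrock_imp_solvable:
  assumes A: "A \<in> carrier_mat n n" and B: "B \<in> carrier_mat n m"
    and C: "C \<in> carrier_mat p n" and D: "D \<in> carrier_mat p m"
    and full: "full_row_rank (rosenbrock A B C D s)"
    and b: "b \<in> carrier_vec n" and d: "d \<in> carrier_vec p"
  shows "\<exists>x\<in>carrier_vec n. \<exists>y\<in>carrier_vec m.
    A *\<^sub>v x - s \<cdot>\<^sub>v x + B *\<^sub>v y = b \<and> C *\<^sub>v x + D *\<^sub>v y = d"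
proof -
  obtain z where z: "z \<in> carrier_vec (n + m)" "rosenbrock A B C D s *\<^sub>v z = b @\<^sub>v d"
    using full b d unfolding full_row_rank_iff_surj[OF rosenbrock_carrier[OF A B C D]] by fastforce
  define x y where "x = vec_first z n" and "y = vec_last z m"
  have xy: "x \<in> carrier_vec n" "y \<in> carrier_vec m" "z = x @\<^sub>v y" using z(1) by (auto simp: x_def y_def)
  have "(A *\<^sub>v x - s \<cdot>\<^sub>v x + B *\<^sub>v y) @\<^sub>v (C *\<^sub>v x + D *\<^sub>v y) = b @\<^sub>v d"
    using z(2) xy A four_block_mat_mult_vec[of "A - s \<cdot>\<^sub>m 1\<^sub>m n" n n B m C p D x y] B C D
    by (simp add: minus_carrier_mat rosenbrock_def shifted_mat_mult_vec)
  then show ?thesis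
    using append_vec_eq[of "A *\<^sub>v x - s \<cdot>\<^sub>v x + B *\<^sub>v y" n b] A B C D xy b by (intro bexI[of _ x] bexI[of _ y]) auto
qed

text \<open>Left null vectors are split into w for the n rows of (A - s I, B) and v for the p rows
  of (C, D). The dual and the controllability arguments use the rank condition in this form.\<close>

lemma full_row_rank_rosenbrock_iff:
  assumes A: "A \<in> carrier_mat n n" and B: "B \<in> carrier_mat n m"
    and C: "C \<in> carrier_mat p n" and D: "D \<in> carrier_mat p m"
  shows "full_row_rank (rosenbrock A B C D s) \<longleftrightarrow>
    (\<forall>w\<in>carrier_vec n. \<forall>v\<in>carrier_vec p.
      A\<^sup>T *\<^sub>v w - s \<cdot>\<^sub>v w + C\<^sup>T *\<^sub>v v = 0\<^sub>v n \<and> B\<^sup>T *\<^sub>v w + D\<^sup>T *\<^sub>v v = 0\<^sub>v m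
      \<longrightarrow> w = 0\<^sub>v n \<and> v = 0\<^sub>v p)"
proof -
  have T: "(rosenbrock A B C D s)\<^sup>T = four_block_mat (A\<^sup>T - s \<cdot>\<^sub>m 1\<^sub>m n) C\<^sup>T B\<^sup>T D\<^sup>T"
  proof -
    have "(A - s \<cdot>\<^sub>m 1\<^sub>m n)\<^sup>T = A\<^sup>T - s \<cdot>\<^sub>m 1\<^sub>m n"
      using A by (intro eq_matI) auto
    then show ?thesis using A transpose_four_block_mat[of "A - s \<cdot>\<^sub>m 1\<^sub>m n" n n B m C p D] B C D by (simp add: minus_carrier_mat rosenbrock_def)
  qed
  have mult: "(rosenbrock A B C D s)\<^sup>T *\<^sub>v (w @\<^sub>v v)
      = (A\<^sup>T *\<^sub>v w - s \<cdot>\<^sub>v w + C\<^sup>T *\<^sub>v v) @\<^sub>v (B\<^sup>T *\<^sub>v w + D\<^sup>T *\<^sub>v v)"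
    if "w \<in> carrier_vec n" "v \<in> carrier_vec p" for w v
    unfolding T using that A B C D four_block_mat_mult_vec[of "A\<^sup>T - s \<cdot>\<^sub>m 1\<^sub>m n" n n "C\<^sup>T" p "B\<^sup>T" m "D\<^sup>T" w v]
    by (simp add: minus_carrier_mat shifted_mat_mult_vec)
  have zero: "x @\<^sub>v y = (0\<^sub>v (i + j) :: complex vec) \<longleftrightarrow> x = 0\<^sub>v i \<and> y = 0\<^sub>v j"
    if "x \<in> carrier_vec i" "y \<in> carrier_vec j" for x y i and j :: nat
  proof -
    have "0\<^sub>v (i + j) = 0\<^sub>v i @\<^sub>v (0\<^sub>v j :: complex vec)" by auto
    then show ?thesis using append_vec_eq[OF that(1), of "0\<^sub>v i" y "0\<^sub>v j"] by (metis zero_carrier_vec)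
  qed
  have cases: "(\<forall>z\<in>carrier_vec (n + p). Q z) \<longleftrightarrow> (\<forall>w\<in>carrier_vec n. \<forall>v\<in>carrier_vec p. Q (w @\<^sub>v v))"
    for Q :: "complex vec \<Rightarrow> bool"
    by (metis append_carrier_vec vec_first_carrier vec_first_last_append vec_last_carrier)
  show ?thesis
    unfolding full_row_rank_iff_left_kernel[OF rosenbrock_carrier[OF A B C D]] cases
    using A B C D by (intro ball_cong refl) (simp add: mult zero)
qed

lemma eig_transpose: "A \<in> carrier_mat n n \<Longrightarrow> eig A\<^sup>T = eig A"
  using eigenvalue_root_char_poly[of A n] eigenvalue_root_char_poly[of "A\<^sup>T" n]
  by (auto simp: eig_def char_poly_transpose_mat)

subsection \<open>The primal equations\<close>

text \<open>The columns of \<open>X\<close> and \<open>Y\<close> are obtained one after the other: when column \<open>k\<close> is treated, the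
  triangular shape of \<open>U\<close> leaves \<open>X\<^sub>k\<close> with coefficient \<open>U\<^sub>k\<^sub>k\<close> and only known columns besides.\<close>

lemma regulator_equation_triangular:
  fixes A B C D U :: "complex mat"
  assumes A: "A \<in> carrier_mat n n" and B: "B \<in> carrier_mat n m"
    and C: "C \<in> carrier_mat p n" and D: "D \<in> carrier_mat p m"
    and U: "U \<in> carrier_mat \<nu> \<nu>" and tri: "upper_triangular U"
    and full: "\<And>j. j < \<nu> \<Longrightarrow> full_row_rank (rosenbrock A B C D (U $$ (j,j)))"
    and P: "P \<in> carrier_mat n \<nu>" and Q: "Q \<in> carrier_mat p \<nu>"
  shows "\<exists>X\<in>carrier_mat n \<nu>. \<exists>Y\<in>carrier_mat m \<nu>.
    X * U = A * X + B * Y + P \<and> 0\<^sub>m p \<nu> = C * X + D * Y + Q"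
proof -
  \<comment> \<open>This is column j of both equations, entry by entry. The sum stops at j because U
    is upper triangular, so the condition involves only the columns of X up to j and survives a
    change of later ones.\<close>
  define good where "good X Y j \<longleftrightarrow> X j \<in> carrier_vec n \<and> Y j \<in> carrier_vec m \<and>
      (\<forall>r<n. (\<Sum>i\<le>j. X i $ r * U $$ (i,j)) = (A *\<^sub>v X j) $ r + (B *\<^sub>v Y j) $ r + P $$ (r,j)) \<and>
      (\<forall>r<p. 0 = (C *\<^sub>v X j) $ r + (D *\<^sub>v Y j) $ r + Q $$ (r,j))"
    for X Y :: "nat \<Rightarrow> complex vec" and j
  have "\<exists>X Y. \<forall>j<k. good X Y j" if "k \<le> \<nu>" for k
    using that
  proof (induction k)
    case (Suc k)
    then obtain X Y where XY: "\<And>j. j < k \<Longrightarrow> good X Y j" by auto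
    \<comment> \<open>The columns already found and the data P form the right-hand side. The summand
      with index k contains the unknown column and moves to the left, where it shifts A by
      \<open>U $$ (k,k)\<close>.\<close>
    define b where "b = vec n (\<lambda>r. (\<Sum>i<k. X i $ r * U $$ (i,k)) - P $$ (r,k))"
    define d where "d = vec p (\<lambda>r. - Q $$ (r,k))"
    obtain x y where xy: "x \<in> carrier_vec n" "y \<in> carrier_vec m"
      "A *\<^sub>v x - U $$ (k,k) \<cdot>\<^sub>v x + B *\<^sub>v y = b" "C *\<^sub>v x + D *\<^sub>v y = d"
      using full_row_rank_rosenbrock_imp_solvable[OF A B C D full[of k], of b d] Suc.prems
      by (auto simp: b_def d_def)
    have 1: "(A *\<^sub>v x) $ r - U $$ (k,k) * x $ r + (B *\<^sub>v y) $ r = (\<Sum>i<k. X i $ r * U $$ (i,k)) - P $$ (r,k)"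
      if "r < n" for r
      using arg_cong[OF xy(3), of "\<lambda>v. v $ r"] that A B xy(1,2) by (simp add: b_def del: index_mult_mat_vec)
    have 2: "(C *\<^sub>v x) $ r + (D *\<^sub>v y) $ r = - Q $$ (r,k)" if "r < p" for r
      using arg_cong[OF xy(4), of "\<lambda>v. v $ r"] that C D xy(1,2) by (simp add: d_def del: index_mult_mat_vec)
    have "good (X(k := x)) (Y(k := y)) j" if "j < Suc k" for j
    proof (cases "j = k")
      case True
      have "(\<Sum>i\<le>k. (X(k := x)) i $ r * U $$ (i,k)) = (\<Sum>i<k. X i $ r * U $$ (i,k)) + x $ r * U $$ (k,k)" for r
        by (simp add: lessThan_Suc_atMost[symmetric])
      then show ?thesis unfolding good_def True using 1 2 xy(1,2) by (auto simp: algebra_simps simp del: index_mult_mat_vec)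
    next
      case False
      then have "j < k" using that by simp
      moreover have "(\<Sum>i\<le>j. (X(k := x)) i $ r * U $$ (i,j)) = (\<Sum>i\<le>j. X i $ r * U $$ (i,j))" for r
        using \<open>j < k\<close> by (intro sum.cong) auto
      ultimately show ?thesis using XY[of j] unfolding good_def by simp
    qed
    then show ?case by blast
  qed simp
  then obtain X Y where XY: "\<And>j. j < \<nu> \<Longrightarrow> good X Y j" by blast
  define X' where "X' = mat n \<nu> (\<lambda>(r,j). X j $ r)"
  define Y' where "Y' = mat m \<nu> (\<lambda>(r,j). Y j $ r)"
  have cols: "col X' j = X j" "col Y' j = Y j" if "j < \<nu>" for j
    using XY[OF that] that by (auto simp: X'_def Y'_def good_def)
  have carr: "X' \<in> carrier_mat n \<nu>" "Y' \<in> carrier_mat m \<nu>" by (auto simp: X'_def Y'_def)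
  have "X' * U = A * X' + B * Y' + P"
  proof (rule eq_matI)
    fix r j assume "r < dim_row (A * X' + B * Y' + P)" "j < dim_col (A * X' + B * Y' + P)"
    then have rj: "r < n" "j < \<nu>" using P by auto
    have "(X' * U) $$ (r,j) = (\<Sum>i<\<nu>. X i $ r * U $$ (i,j))"
      using rj U carr by (auto simp: scalar_prod_def X'_def atLeast0LessThan intro!: sum.cong)
    \<comment> \<open>The entries of U below the diagonal vanish, so the summands with i > j drop
      out.\<close>
    also have "\<dots> = (\<Sum>i\<le>j. X i $ r * U $$ (i,j))"
      using rj U by (intro sum.mono_neutral_right) (auto simp: upper_triangularD[OF tri])
    finally show "(X' * U) $$ (r,j) = (A * X' + B * Y' + P) $$ (r,j)"
      using XY[OF rj(2)] rj A B P carr by (simp add: good_def cols)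
  qed (use carr U P in auto)
  moreover have "0\<^sub>m p \<nu> = C * X' + D * Y' + Q"
    by (rule eq_matI) (use XY C D Q carr in \<open>auto simp: good_def cols\<close>)
  ultimately show ?thesis using carr by blast
qed

text \<open>With F = S U T and T inverse to S, multiplication by S on the right changes the system
  for F with data P, Q into the one for U with data P S, Q S. A solution of the latter is carried
  back by multiplication with T.\<close>

lemma regulator_equation_solvable:
  fixes A B C D F :: "complex mat"
  assumes A: "A \<in> carrier_mat n n" and B: "B \<in> carrier_mat n m"
    and C: "C \<in> carrier_mat p n" and D: "D \<in> carrier_mat p m"
    and F: "F \<in> carrier_mat \<nu> \<nu>"
    and full: "\<And>s. s \<in> eig F \<Longrightarrow> full_row_rank (rosenbrock A B C D s)"
    and P: "P \<in> carrier_mat n \<nu>" and Q: "Q \<in> carrier_mat p \<nu>"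
  shows "\<exists>X\<in>carrier_mat n \<nu>. \<exists>Y\<in>carrier_mat m \<nu>.
    X * F = A * X + B * Y + P \<and> 0\<^sub>m p \<nu> = C * X + D * Y + Q"
proof -
  obtain es where es: "char_poly F = (\<Prod>e\<leftarrow>es. [:- e, 1:])"
    using char_poly_factorized[OF F] by blast
  obtain U S T where "schur_decomposition F es = (U, S, T)" by (cases "schur_decomposition F es") auto
  from schur_decomposition[OF F es this]
  have sim: "similar_mat_wit F U S T" and tri: "upper_triangular U" and diag: "diag_mat U = es" by auto
  note w = similar_mat_witD2[OF F sim]
  \<comment> \<open>The diagonal of U lists the roots of the characteristic polynomial of F, so the
    rank condition is available at each diagonal entry.\<close>
  have "U $$ (j,j) \<in> eig F" if "j < \<nu>" for j
  proof -
    have "U $$ (j,j) \<in> set es" using that w(5) diag by (force simp: diag_mat_def)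
    then have "poly (char_poly F) (U $$ (j,j)) = 0" unfolding es poly_prod_list by (force simp: prod_list_zero_iff)
    then show ?thesis by (simp add: eig_def eigenvalue_root_char_poly[OF F])
  qed
  then obtain X Y where XY: "X \<in> carrier_mat n \<nu>" "Y \<in> carrier_mat m \<nu>"
    "X * U = A * X + B * Y + P * S" "0\<^sub>m p \<nu> = C * X + D * Y + Q * S"
    using regulator_equation_triangular[OF A B C D w(5) tri full, of "P * S" "Q * S"] P Q w by auto
  have PST: "P * S * T = P" and QST: "Q * S * T = Q"
    using assoc_mult_mat[OF P w(6,7)] assoc_mult_mat[OF Q w(6,7)] P Q w(1) by simp_all
  have "X * T * F = X * T * (S * U * T)" using w(3) by simp
  also have "\<dots> = X * (T * S) * U * T" using XY(1) w(5-7) by (simp add: assoc_mult_mat[of _ _ \<nu> _ \<nu> _ \<nu>])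
  also have "\<dots> = (A * X + B * Y + P * S) * T" using XY(1,3) w(2) by simp
  also have "\<dots> = A * (X * T) + B * (Y * T) + P"
    using A B P XY(1,2) w(6,7) PST by (simp add: add_mult_distrib_mat[of _ n \<nu>] assoc_mult_mat[of _ n _ _ \<nu> _ \<nu>])
  finally have 1: "X * T * F = A * (X * T) + B * (Y * T) + P" .
  have "0\<^sub>m p \<nu> = (C * X + D * Y + Q * S) * T" using XY(4) w(7) by (metis left_mult_zero_mat)
  also have "\<dots> = C * (X * T) + D * (Y * T) + Q"
    using C D Q XY(1,2) w(6,7) QST by (simp add: add_mult_distrib_mat[of _ p \<nu>] assoc_mult_mat[of _ p _ _ \<nu> _ \<nu>])
  finally have 2: "0\<^sub>m p \<nu> = C * (X * T) + D * (Y * T) + Q" .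
  show ?thesis using 1 2 XY(1,2) w(7) by (intro bexI[of _ "X * T"] bexI[of _ "Y * T"]) auto
qed

section \<open>Vanishing differences\<close>

lemma vec_minus_eq_0_iff:
  fixes u v :: "'a :: ab_group_add vec"
  assumes "u \<in> carrier_vec k" "v \<in> carrier_vec k"
  shows "u - v = 0\<^sub>v k \<longleftrightarrow> u = v"
proof
  assume eq: "u - v = 0\<^sub>v k"
  show "u = v"
  proof (rule eq_vecI)
    fix i assume "i < dim_vec v"
    then show "u $ i = v $ i" using arg_cong[OF eq, of "\<lambda>w. w $ i"] assms by simp
  qed (use assms in simp)
qed (use assms in auto)

lemma mat_minus_eq_0_iff:
  fixes X Y :: "'a :: ab_group_add mat"
  assumes "X \<in> carrier_mat k l" "Y \<in> carrier_mat k l"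
  shows "X - Y = 0\<^sub>m k l \<longleftrightarrow> X = Y"
proof
  assume eq: "X - Y = 0\<^sub>m k l"
  show "X = Y"
  proof (rule eq_matI)
    fix i j assume "i < dim_row Y" "j < dim_col Y"
    then show "X $$ (i,j) = Y $$ (i,j)" using arg_cong[OF eq, of "\<lambda>Z. Z $$ (i,j)"] assms by simp
  qed (use assms in auto)
qed (use assms in auto)

subsection \<open>Trace duality\<close>

definition mat_trace :: "'a :: comm_ring_1 mat \<Rightarrow> 'a" where
  "mat_trace X = (\<Sum>i<dim_row X. X $$ (i,i))"

lemma mat_trace_add:
  "X \<in> carrier_mat k k \<Longrightarrow> Y \<in> carrier_mat k k \<Longrightarrow> mat_trace (X + Y) = mat_trace X + mat_trace Y"
  by (simp add: mat_trace_def sum.distrib)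

lemma mat_trace_minus:
  "X \<in> carrier_mat k k \<Longrightarrow> Y \<in> carrier_mat k k \<Longrightarrow> mat_trace (X - Y) = mat_trace X - mat_trace Y"
  by (simp add: mat_trace_def sum_subtractf)

lemma mat_trace_mult_commute:
  assumes "X \<in> carrier_mat k l" "Y \<in> carrier_mat l k"
  shows "mat_trace (X * Y) = mat_trace (Y * X)"
proof -
  have "mat_trace (X * Y) = (\<Sum>i<k. \<Sum>j<l. X $$ (i,j) * Y $$ (j,i))"
    using assms by (simp add: mat_trace_def scalar_prod_def atLeast0LessThan)
  also have "\<dots> = (\<Sum>j<l. \<Sum>i<k. Y $$ (j,i) * X $$ (i,j))"
    by (subst sum.swap) (simp add: mult.commute)
  also have "\<dots> = mat_trace (Y * X)"
    using assms by (simp add: mat_trace_def scalar_prod_def atLeast0LessThan)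
  finally show ?thesis .
qed

text \<open>The trace pairing is nondegenerate: testing against the matrix unit with its 1 at
  position (j,i) returns the entry of G at (i,j).\<close>

lemma mat_eq_0_if_trace_mult_eq_0:
  fixes G :: "'a :: comm_ring_1 mat"
  assumes G: "G \<in> carrier_mat k l"
    and tr: "\<And>Y. Y \<in> carrier_mat l k \<Longrightarrow> mat_trace (G * Y) = 0"
  shows "G = 0\<^sub>m k l"
proof (rule eq_matI)
  fix i j assume "i < dim_row (0\<^sub>m k l :: 'a mat)" "j < dim_col (0\<^sub>m k l :: 'a mat)"
  then have ij: "i < k" "j < l" by auto
  define Y :: "'a mat" where "Y = mat l k (\<lambda>(a,b). if a = j \<and> b = i then 1 else 0)"
  have Y: "Y \<in> carrier_mat l k" by (simp add: Y_def)
  have "(G * Y) $$ (a,a) = (if a = i then G $$ (i,j) else 0)" if "a < k" for a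
    using that ij G by (simp add: Y_def scalar_prod_def if_distrib cong: if_cong)
  then have "mat_trace (G * Y) = G $$ (i,j)" using G ij by (simp add: mat_trace_def)
  then show "G $$ (i,j) = 0\<^sub>m k l $$ (i,j)" using tr[OF Y] ij by simp
qed (use G in auto)

text \<open>By cyclicity, tr (F M X) = tr (M X F). Hence the Sylvester operators on M and on X are
  adjoint to each other up to sign.\<close>

lemma mat_trace_sylvester:
  fixes A F M X :: "'a :: comm_ring_1 mat"
  assumes A: "A \<in> carrier_mat n n" and F: "F \<in> carrier_mat \<nu> \<nu>"
    and M: "M \<in> carrier_mat \<nu> n" and X: "X \<in> carrier_mat n \<nu>"
  shows "mat_trace ((M * A - F * M) * X) = - mat_trace (M * (X * F - A * X))"
proof -
  have "mat_trace ((M * A - F * M) * X) = mat_trace (M * A * X) - mat_trace (F * M * X)"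
    using assms by (simp add: minus_mult_distrib_mat[of _ \<nu> n] mat_trace_minus[of _ \<nu>])
  also have "F * M * X = F * (M * X)" by (rule assoc_mult_mat[OF F M X])
  also have "mat_trace \<dots> = mat_trace (M * X * F)"
    using assms by (intro mat_trace_mult_commute) auto
  also have "mat_trace (M * A * X) - mat_trace (M * X * F) = - (mat_trace (M * (X * F)) - mat_trace (M * (A * X)))"
    using assms by (simp add: assoc_mult_mat[of _ \<nu> n _ n _ \<nu>] assoc_mult_mat[of _ \<nu> n _ \<nu> _ \<nu>])
  also have "\<dots> = - mat_trace (M * (X * F - A * X))"
    using assms by (simp add: mult_minus_distrib_mat[of _ \<nu> n _ \<nu>] mat_trace_minus[of _ \<nu>])
  finally show ?thesis .
qed

lemma no_left_eigenvector:
  assumes A: "A \<in> carrier_mat n n" and s: "s \<notin> eig A"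
    and w: "w \<in> carrier_vec n" and eq: "A\<^sup>T *\<^sub>v w - s \<cdot>\<^sub>v w = 0\<^sub>v n"
  shows "w = 0\<^sub>v n"
proof (rule ccontr)
  assume "w \<noteq> 0\<^sub>v n"
  moreover have "A\<^sup>T *\<^sub>v w = s \<cdot>\<^sub>v w"
    using eq vec_minus_eq_0_iff[of "A\<^sup>T *\<^sub>v w" n "s \<cdot>\<^sub>v w"] w A by simp
  ultimately have "s \<in> eig A\<^sup>T" using w A by (auto simp: eig_def eigenvalue_def eigenvector_def)
  then show False using s eig_transpose[OF A] by auto
qed

subsection \<open>Sylvester equations\<close>

text \<open>This is the regulator equation with m = p = 0. The system matrix is then A - s I, whose
  left kernel is trivial because an eigenvalue s of F is not one of A.\<close>

lemma sylvester_solvable: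
  assumes A: "A \<in> carrier_mat n n" and F: "F \<in> carrier_mat \<nu> \<nu>"
    and disj: "eig A \<inter> eig F = {}" and R: "R \<in> carrier_mat n \<nu>"
  shows "\<exists>X\<in>carrier_mat n \<nu>. X * F - A * X = R"
proof -
  have "full_row_rank (rosenbrock A (0\<^sub>m n 0) (0\<^sub>m 0 n) (0\<^sub>m 0 0) s)" if "s \<in> eig F" for s
  proof -
    show ?thesis
      unfolding full_row_rank_rosenbrock_iff[OF A zero_carrier_mat zero_carrier_mat zero_carrier_mat]
    proof (intro ballI impI conjI, elim conjE)
      fix w u :: "complex vec"
      assume w: "w \<in> carrier_vec n" and u: "u \<in> carrier_vec 0"
        and null: "A\<^sup>T *\<^sub>v w - s \<cdot>\<^sub>v w + (0\<^sub>m 0 n)\<^sup>T *\<^sub>v u = 0\<^sub>v n"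
      \<comment> \<open>A product over an empty inner dimension is zero.\<close>
      have u0: "(0\<^sub>m 0 n)\<^sup>T *\<^sub>v u = 0\<^sub>v n"
        using u by (intro eq_vecI) (auto simp: scalar_prod_def)
      have "A\<^sup>T *\<^sub>v w - s \<cdot>\<^sub>v w = 0\<^sub>v n" using null[unfolded u0] A w by simp
      then show "w = 0\<^sub>v n" using no_left_eigenvector[OF A _ w] \<open>s \<in> eig F\<close> disj by blast
    qed (auto intro: eq_vecI)
  qed
  from regulator_equation_solvable[OF A zero_carrier_mat zero_carrier_mat zero_carrier_mat F this R, of "0\<^sub>m 0 \<nu>"]
  obtain X Y where X: "X \<in> carrier_mat n \<nu>" and Y: "Y \<in> carrier_mat 0 \<nu>"
    and eq: "X * F = A * X + 0\<^sub>m n 0 * Y + R" by auto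
  have "X * F - A * X = R"
    unfolding eq using X Y A R by (intro eq_matI) (auto simp: scalar_prod_def)
  then show ?thesis using X by blast
qed

text \<open>Uniqueness follows from solvability of the adjoint equation: with A and F exchanged,
  every R has the form M A - F M, so X - Y is orthogonal to every R in the trace pairing.\<close>

lemma sylvester_unique:
  assumes A: "A \<in> carrier_mat n n" and F: "F \<in> carrier_mat \<nu> \<nu>"
    and disj: "eig A \<inter> eig F = {}"
    and X: "X \<in> carrier_mat n \<nu>" and Y: "Y \<in> carrier_mat n \<nu>"
    and eq: "X * F - A * X = Y * F - A * Y"
  shows "X = Y"
proof -
  have "X - Y = 0\<^sub>m n \<nu>"
  proof (rule mat_eq_0_if_trace_mult_eq_0)
    show "X - Y \<in> carrier_mat n \<nu>" using Y by (rule minus_carrier_mat)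
    fix R :: "complex mat" assume R: "R \<in> carrier_mat \<nu> n"
    obtain M where M: "M \<in> carrier_mat \<nu> n" and MR: "M * A - F * M = R"
      using sylvester_solvable[OF F A _ R] disj by auto
    have "mat_trace (X * R) = mat_trace (Y * R)"
      using mat_trace_sylvester[OF A F M X] mat_trace_sylvester[OF A F M Y]
        mat_trace_mult_commute[OF R X] mat_trace_mult_commute[OF R Y] by (simp add: MR eq)
    then show "mat_trace ((X - Y) * R) = 0"
      using X Y R by (simp add: minus_mult_distrib_mat[of _ n \<nu>] mat_trace_minus[of _ n])
  qed
  then show ?thesis using X Y by (simp add: mat_minus_eq_0_iff)
qed

text \<open>Uniqueness for the Sylvester equation makes the definite description in
  \<open>Cp\<close> denote the given solution.\<close>

lemma Cp_eq:
  assumes A: "A \<in> carrier_mat n n" and F: "F \<in> carrier_mat \<nu> \<nu>"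
    and disj: "eig A \<inter> eig F = {}"
    and X: "X \<in> carrier_mat n \<nu>" and eq: "X * F - A * X = B * H"
  shows "Cp A B C D F H = C * X + D * H"
proof -
  have "(THE X. X \<in> carrier_mat (dim_row A) (dim_row F) \<and> X * F - A * X = B * H) = X"
  proof (rule the_equality)
    fix Y assume "Y \<in> carrier_mat (dim_row A) (dim_row F) \<and> Y * F - A * Y = B * H"
    then have Y: "Y \<in> carrier_mat n \<nu>" "Y * F - A * Y = B * H" using A F by simp_all
    show "Y = X" by (rule sylvester_unique[OF A F disj Y(1) X trans[OF Y(2) eq[symmetric]]])
  qed (use X eq A F in simp)
  then show ?thesis by (simp add: Cp_def)
qed

lemma Cd_eq:
  assumes A: "A \<in> carrier_mat n n" and F: "F \<in> carrier_mat \<nu> \<nu>"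
    and disj: "eig A \<inter> eig F = {}"
    and M: "M \<in> carrier_mat \<nu> n" and eq: "M * A - F * M = G * C"
  shows "Cd A B C D F G = - (M * B) + G * D"
proof -
  have "(THE M. M \<in> carrier_mat (dim_row F) (dim_row A) \<and> M * A - F * M = G * C) = M"
  proof (rule the_equality)
    fix N assume "N \<in> carrier_mat (dim_row F) (dim_row A) \<and> N * A - F * N = G * C"
    then have N: "N \<in> carrier_mat \<nu> n" "N * A - F * N = G * C" using A F by simp_all
    have "eig F \<inter> eig A = {}" using disj by blast
    then show "N = M" by (rule sylvester_unique[OF F A _ N(1) M trans[OF N(2) eq[symmetric]]])
  qed (use M eq A F in simp)
  then show ?thesis by (simp add: Cd_def)
qed

subsection \<open>Left null vectors of the system matrix\<close>

text \<open>The witness is w = -M^T phi, where M solves the Sylvester equation in \<open>Cd\<close>.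
  Transposing that equation and applying it to phi, with (F M)^T phi = s M^T phi, gives the first
  identity. The second is the transposed formula for \<open>Cd\<close>.\<close>

lemma Cd_left_eigenvector:
  assumes A: "A \<in> carrier_mat n n" and B: "B \<in> carrier_mat n m"
    and C: "C \<in> carrier_mat p n" and D: "D \<in> carrier_mat p m"
    and F: "F \<in> carrier_mat \<nu> \<nu>" and disj: "eig A \<inter> eig F = {}"
    and G: "G \<in> carrier_mat \<nu> p"
    and \<phi>: "\<phi> \<in> carrier_vec \<nu>" and ev: "F\<^sup>T *\<^sub>v \<phi> = s \<cdot>\<^sub>v \<phi>"
  shows "\<exists>w\<in>carrier_vec n.
    A\<^sup>T *\<^sub>v w - s \<cdot>\<^sub>v w + C\<^sup>T *\<^sub>v (G\<^sup>T *\<^sub>v \<phi>) = 0\<^sub>v n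
    \<and> B\<^sup>T *\<^sub>v w + D\<^sup>T *\<^sub>v (G\<^sup>T *\<^sub>v \<phi>) = (Cd A B C D F G)\<^sup>T *\<^sub>v \<phi>"
proof -
  obtain M where M: "M \<in> carrier_mat \<nu> n" and MGC: "M * A - F * M = G * C"
    using sylvester_solvable[OF F A _ mult_carrier_mat[OF G C]] disj by auto
  define u where "u = M\<^sup>T *\<^sub>v \<phi>"
  have u: "u \<in> carrier_vec n" and v: "G\<^sup>T *\<^sub>v \<phi> \<in> carrier_vec p" using M G \<phi> by (simp_all add: u_def)
  have minus: "N *\<^sub>v (- u) = - (N *\<^sub>v u)" if "N \<in> carrier_mat k n" for N and k :: nat
    using that u by (intro eq_vecI) auto
  have "C\<^sup>T *\<^sub>v (G\<^sup>T *\<^sub>v \<phi>) = (G * C)\<^sup>T *\<^sub>v \<phi>"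
    using G C \<phi> by (simp add: transpose_mult[of _ \<nu> p] assoc_mult_mat_vec[of _ n p _ \<nu>])
  also have "\<dots> = (M * A)\<^sup>T *\<^sub>v \<phi> - (F * M)\<^sup>T *\<^sub>v \<phi>"
    unfolding MGC[symmetric] using A F M \<phi>
    by (simp add: transpose_minus[of _ \<nu> n] minus_mult_distrib_mat_vec[of _ n \<nu>])
  also have "(M * A)\<^sup>T *\<^sub>v \<phi> = A\<^sup>T *\<^sub>v u"
    using M A \<phi> by (simp add: u_def transpose_mult[of _ \<nu> n] assoc_mult_mat_vec[of _ n n _ \<nu>])
  also have "(F * M)\<^sup>T *\<^sub>v \<phi> = s \<cdot>\<^sub>v u"
    using F M \<phi> ev by (simp add: u_def transpose_mult[of _ \<nu> \<nu>] assoc_mult_mat_vec[of _ n \<nu> _ \<nu>] mult_mat_vec[of _ n \<nu>])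
  finally have "A\<^sup>T *\<^sub>v (- u) - s \<cdot>\<^sub>v (- u) + C\<^sup>T *\<^sub>v (G\<^sup>T *\<^sub>v \<phi>) = 0\<^sub>v n"
    using A u by (simp add: minus[of _ n]) (intro eq_vecI; simp)
  moreover have "(Cd A B C D F G)\<^sup>T *\<^sub>v \<phi> = B\<^sup>T *\<^sub>v (- u) + D\<^sup>T *\<^sub>v (G\<^sup>T *\<^sub>v \<phi>)"
  proof -
    have "(M * B)\<^sup>T *\<^sub>v \<phi> = B\<^sup>T *\<^sub>v u"
      using M B \<phi> by (simp add: u_def transpose_mult[of _ \<nu> n] assoc_mult_mat_vec[of _ m n _ \<nu>])
    moreover have "(G * D)\<^sup>T *\<^sub>v \<phi> = D\<^sup>T *\<^sub>v (G\<^sup>T *\<^sub>v \<phi>)"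
      using G D \<phi> by (simp add: transpose_mult[of _ \<nu> p] assoc_mult_mat_vec[of _ m p _ \<nu>])
    moreover have "(- (M * B) + G * D)\<^sup>T *\<^sub>v \<phi> = - ((M * B)\<^sup>T *\<^sub>v \<phi>) + (G * D)\<^sup>T *\<^sub>v \<phi>"
      using M B G D \<phi>
      by (simp add: transpose_add[of _ \<nu> m] transpose_uminus add_mult_distrib_mat_vec[of _ m \<nu>])
    ultimately show ?thesis unfolding Cd_eq[OF A F disj M MGC] using B by (simp add: minus[of _ m])
  qed
  ultimately show ?thesis using u by (intro bexI[of _ "- u"]) auto
qed

section \<open>Left eigenvectors annihilated by G and by the cascade\<close>

lemma Cd_carrier:
  assumes A: "A \<in> carrier_mat n n" and C: "C \<in> carrier_mat p n" and D: "D \<in> carrier_mat p m"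
    and F: "F \<in> carrier_mat \<nu> \<nu>" and disj: "eig A \<inter> eig F = {}" and G: "G \<in> carrier_mat \<nu> p"
  shows "Cd A B C D F G \<in> carrier_mat \<nu> m"
proof -
  obtain M where M: "M \<in> carrier_mat \<nu> n" and MGC: "M * A - F * M = G * C"
    using sylvester_solvable[OF F A _ mult_carrier_mat[OF G C]] disj by auto
  show ?thesis unfolding Cd_eq[OF A F disj M MGC] using G D by auto
qed

lemma mat_kernel_char_transpose:
  fixes F :: "'a :: field mat"
  assumes F: "F \<in> carrier_mat k k"
  shows "mat_kernel (s \<cdot>\<^sub>m 1\<^sub>m k - F\<^sup>T) = {\<phi> \<in> carrier_vec k. F\<^sup>T *\<^sub>v \<phi> = s \<cdot>\<^sub>v \<phi>}"
proof -
  have "(s \<cdot>\<^sub>m 1\<^sub>m k - F\<^sup>T) *\<^sub>v \<phi> = 0\<^sub>v k \<longleftrightarrow> F\<^sup>T *\<^sub>v \<phi> = s \<cdot>\<^sub>v \<phi>" if \<phi>: "\<phi> \<in> carrier_vec k" for \<phi>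
  proof -
    have "(s \<cdot>\<^sub>m 1\<^sub>m k - F\<^sup>T) *\<^sub>v \<phi> = s \<cdot>\<^sub>v \<phi> - F\<^sup>T *\<^sub>v \<phi>"
      using minus_mult_distrib_mat_vec[of "s \<cdot>\<^sub>m 1\<^sub>m k" k k "F\<^sup>T" \<phi>] \<phi> F
      by (auto intro!: eq_vecI simp: smult_scalar_prod_distrib[of _ k])
    moreover have "s \<cdot>\<^sub>v \<phi> - F\<^sup>T *\<^sub>v \<phi> = 0\<^sub>v k \<longleftrightarrow> F\<^sup>T *\<^sub>v \<phi> = s \<cdot>\<^sub>v \<phi>"
      using vec_minus_eq_0_iff[of "s \<cdot>\<^sub>v \<phi>" k "F\<^sup>T *\<^sub>v \<phi>"] \<phi> F by auto
    ultimately show ?thesis by simp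
  qed
  moreover have "s \<cdot>\<^sub>m 1\<^sub>m k - F\<^sup>T \<in> carrier_mat k k" using F by (intro minus_carrier_mat) simp
  ultimately show ?thesis by (auto simp: mat_kernel)
qed

text \<open>Under these hypotheses \<open>Cd_left_eigenvector\<close> produces a left null vector
  (w, G^T phi) of the system matrix, and full row rank makes it zero.\<close>

lemma full_rank_imp_Cd_eigenvector:
  assumes A: "A \<in> carrier_mat n n" and B: "B \<in> carrier_mat n m"
    and C: "C \<in> carrier_mat p n" and D: "D \<in> carrier_mat p m"
    and F: "F \<in> carrier_mat \<nu> \<nu>" and disj: "eig A \<inter> eig F = {}"
    and G: "G \<in> carrier_mat \<nu> p"
    and full: "full_row_rank (rosenbrock A B C D s)"
    and \<phi>: "\<phi> \<in> carrier_vec \<nu>" and ev: "F\<^sup>T *\<^sub>v \<phi> = s \<cdot>\<^sub>v \<phi>"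
    and zero: "(Cd A B C D F G)\<^sup>T *\<^sub>v \<phi> = 0\<^sub>v m"
  shows "G\<^sup>T *\<^sub>v \<phi> = 0\<^sub>v p"
proof -
  have "G\<^sup>T *\<^sub>v \<phi> \<in> carrier_vec p" using G \<phi> by simp
  then show ?thesis
    using Cd_left_eigenvector[OF A B C D F disj G \<phi> ev] full zero
    unfolding full_row_rank_rosenbrock_iff[OF A B C D] by auto
qed

text \<open>Once G^T phi = 0, the vector w of \<open>Cd_left_eigenvector\<close> satisfies A^T w = s
  w. As s is not an eigenvalue of A, w = 0, and with it the value B^T w + D^T G^T phi
  vanishes.\<close>

lemma Cd_eigenvector_imp:
  assumes A: "A \<in> carrier_mat n n" and B: "B \<in> carrier_mat n m"
    and C: "C \<in> carrier_mat p n" and D: "D \<in> carrier_mat p m"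
    and F: "F \<in> carrier_mat \<nu> \<nu>" and disj: "eig A \<inter> eig F = {}"
    and G: "G \<in> carrier_mat \<nu> p" and s: "s \<notin> eig A"
    and \<phi>: "\<phi> \<in> carrier_vec \<nu>" and ev: "F\<^sup>T *\<^sub>v \<phi> = s \<cdot>\<^sub>v \<phi>"
    and zero: "G\<^sup>T *\<^sub>v \<phi> = 0\<^sub>v p"
  shows "(Cd A B C D F G)\<^sup>T *\<^sub>v \<phi> = 0\<^sub>v m"
proof -
  have z: "N\<^sup>T *\<^sub>v 0\<^sub>v p = 0\<^sub>v k" if "N \<in> carrier_mat p k" for N :: "complex mat" and k
    using that by (intro eq_vecI) auto
  obtain w where w: "w \<in> carrier_vec n" "A\<^sup>T *\<^sub>v w - s \<cdot>\<^sub>v w + 0\<^sub>v n = 0\<^sub>v n"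
      "B\<^sup>T *\<^sub>v w + 0\<^sub>v m = (Cd A B C D F G)\<^sup>T *\<^sub>v \<phi>"
    using Cd_left_eigenvector[OF A B C D F disj G \<phi> ev] unfolding zero z[OF C] z[OF D] by blast
  have "w = 0\<^sub>v n" using no_left_eigenvector[OF A s w(1)] w(1,2) A by simp
  moreover have "B\<^sup>T *\<^sub>v 0\<^sub>v n = 0\<^sub>v m" using B by (intro eq_vecI) auto
  ultimately show ?thesis using w(3) by simp
qed

text \<open>As \<open>s\<close> is not an eigenvalue of \<open>A\<close>, \<open>w\<close> is determined by \<open>v\<close>; hence a left null vector \<open>(w, v)\<close> of the system matrix
  with \<open>v = G\<^sup>T\<phi>\<close> is the one that \<open>\<phi>\<close> produces.\<close>

lemma full_rank_if_Cd_eigenvector: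
  assumes A: "A \<in> carrier_mat n n" and B: "B \<in> carrier_mat n m"
    and C: "C \<in> carrier_mat p n" and D: "D \<in> carrier_mat p m"
    and F: "F \<in> carrier_mat \<nu> \<nu>" and disj: "eig A \<inter> eig F = {}"
    and G: "G \<in> carrier_mat \<nu> p" and s: "s \<notin> eig A"
    and onto: "(\<lambda>x. G\<^sup>T *\<^sub>v x) ` mat_kernel (s \<cdot>\<^sub>m 1\<^sub>m \<nu> - F\<^sup>T) = carrier_vec p"
    and ctrl: "\<And>\<phi>. \<phi> \<in> carrier_vec \<nu> \<Longrightarrow> F\<^sup>T *\<^sub>v \<phi> = s \<cdot>\<^sub>v \<phi> \<Longrightarrow>
      (Cd A B C D F G)\<^sup>T *\<^sub>v \<phi> = 0\<^sub>v m \<Longrightarrow> \<phi> = 0\<^sub>v \<nu>"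
  shows "full_row_rank (rosenbrock A B C D s)"
  unfolding full_row_rank_rosenbrock_iff[OF A B C D]
proof (intro ballI impI)
  fix w v assume w: "w \<in> carrier_vec n" and v: "v \<in> carrier_vec p"
    and null: "A\<^sup>T *\<^sub>v w - s \<cdot>\<^sub>v w + C\<^sup>T *\<^sub>v v = 0\<^sub>v n \<and> B\<^sup>T *\<^sub>v w + D\<^sup>T *\<^sub>v v = 0\<^sub>v m"
  \<comment> \<open>The surjectivity hypothesis enters here: v is the image under G^T of some phi in
    the left eigenspace of F.\<close>
  obtain \<phi> where \<phi>: "\<phi> \<in> carrier_vec \<nu>" "F\<^sup>T *\<^sub>v \<phi> = s \<cdot>\<^sub>v \<phi>" and v_eq: "v = G\<^sup>T *\<^sub>v \<phi>"
    using v[folded onto] unfolding mat_kernel_char_transpose[OF F] by (elim imageE CollectE conjE)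
  obtain w' where w': "w' \<in> carrier_vec n" "A\<^sup>T *\<^sub>v w' - s \<cdot>\<^sub>v w' + C\<^sup>T *\<^sub>v v = 0\<^sub>v n"
      "B\<^sup>T *\<^sub>v w' + D\<^sup>T *\<^sub>v v = (Cd A B C D F G)\<^sup>T *\<^sub>v \<phi>"
    using Cd_left_eigenvector[OF A B C D F disj G \<phi>] unfolding v_eq by (elim bexE conjE)
  \<comment> \<open>Both w and w' solve the first equation for the same v. Their difference
    satisfies the eigenvector equation of A^T at s and is therefore zero.\<close>
  have "A\<^sup>T *\<^sub>v (w - w') - s \<cdot>\<^sub>v (w - w')
      = (A\<^sup>T *\<^sub>v w - s \<cdot>\<^sub>v w + C\<^sup>T *\<^sub>v v) - (A\<^sup>T *\<^sub>v w' - s \<cdot>\<^sub>v w' + C\<^sup>T *\<^sub>v v)"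
    unfolding mult_minus_distrib_mat_vec[OF transpose_carrier_mat[THEN iffD2, OF A] w w'(1)]
    using A C w w'(1) v by (intro eq_vecI) (simp_all add: right_diff_distrib del: index_mult_mat_vec)
  also have "\<dots> = 0\<^sub>v n" unfolding w'(2) conjunct1[OF null] by simp
  finally have "w - w' = 0\<^sub>v n" using no_left_eigenvector[OF A s] w w'(1) by simp
  then have ww': "w = w'" by (rule iffD1[OF vec_minus_eq_0_iff[OF w w'(1)]])
  have "(Cd A B C D F G)\<^sup>T *\<^sub>v \<phi> = 0\<^sub>v m"
    using conjunct2[OF null] unfolding ww' w'(3) .
  then have "\<phi> = 0\<^sub>v \<nu>" by (rule ctrl[OF \<phi>])
  then have v0: "v = 0\<^sub>v p" unfolding v_eq using G by (intro eq_vecI) auto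
  have C0: "C\<^sup>T *\<^sub>v 0\<^sub>v p = 0\<^sub>v n" using C by (intro eq_vecI) auto
  have "A\<^sup>T *\<^sub>v w - s \<cdot>\<^sub>v w + 0\<^sub>v n = 0\<^sub>v n"
    using conjunct1[OF null] unfolding v0 C0 .
  then have "A\<^sup>T *\<^sub>v w - s \<cdot>\<^sub>v w = 0\<^sub>v n" using A w by simp
  from no_left_eigenvector[OF A s w this] v0 show "w = 0\<^sub>v n \<and> v = 0\<^sub>v p" by (rule conjI)
qed

subsection \<open>Homogeneous dual equations\<close>

text \<open>For M = x w^T and G = -x v^T with F x = s x, one has M A - F M = x (A^T w - s w)^T = -x
  (C^T v)^T and M B = x (B^T w)^T = -x (D^T v)^T. An outer product of nonzero vectors is
  nonzero.\<close>

lemma homogeneous_solution_if_rank_deficient: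
  assumes A: "A \<in> carrier_mat n n" and B: "B \<in> carrier_mat n m"
    and C: "C \<in> carrier_mat p n" and D: "D \<in> carrier_mat p m"
    and F: "F \<in> carrier_mat \<nu> \<nu>" and s: "s \<in> eig F"
    and deficient: "\<not> full_row_rank (rosenbrock A B C D s)"
  shows "\<exists>M\<in>carrier_mat \<nu> n. \<exists>G\<in>carrier_mat \<nu> p.
    M * A - F * M = G * C \<and> M * B = G * D \<and> (M \<noteq> 0\<^sub>m \<nu> n \<or> G \<noteq> 0\<^sub>m \<nu> p)"
proof -
  obtain w v where w: "w \<in> carrier_vec n" and v: "v \<in> carrier_vec p"
    and null1: "A\<^sup>T *\<^sub>v w - s \<cdot>\<^sub>v w + C\<^sup>T *\<^sub>v v = 0\<^sub>v n" and null2: "B\<^sup>T *\<^sub>v w + D\<^sup>T *\<^sub>v v = 0\<^sub>v m"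
    and nz: "w \<noteq> 0\<^sub>v n \<or> v \<noteq> 0\<^sub>v p"
    using deficient unfolding full_row_rank_rosenbrock_iff[OF A B C D] by blast
  obtain x where x: "x \<in> carrier_vec \<nu>" "x \<noteq> 0\<^sub>v \<nu>" "F *\<^sub>v x = s \<cdot>\<^sub>v x"
    using s F by (auto simp: eig_def eigenvalue_def eigenvector_def)
  \<comment> \<open>This is the rank-one matrix x u^T.\<close>
  define outer :: "nat \<Rightarrow> complex vec \<Rightarrow> complex mat"
    where "outer k u = mat \<nu> k (\<lambda>(i,j). x $ i * u $ j)" for k u
  have carr: "outer k u \<in> carrier_mat \<nu> k" for k u by (simp add: outer_def)
  have right: "(outer k u * N) $$ (i,j) = x $ i * (N\<^sup>T *\<^sub>v u) $ j"
    if "u \<in> carrier_vec k" "N \<in> carrier_mat k l" "i < \<nu>" "j < l" for k l u N i j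
    using that x(1) by (auto simp: outer_def scalar_prod_def sum_distrib_left mult_ac intro!: sum.cong)
  have left: "(F * outer k u) $$ (i,j) = s * x $ i * u $ j"
    if "u \<in> carrier_vec k" "i < \<nu>" "j < k" for k u i j
  proof -
    have "(F * outer k u) $$ (i,j) = (F *\<^sub>v x) $ i * u $ j"
      using that x(1) F by (auto simp: outer_def scalar_prod_def sum_distrib_right sum_distrib_left mult_ac intro!: sum.cong)
    then show ?thesis using x(1,3) that by simp
  qed
  have outer_nz: "outer k u \<noteq> 0\<^sub>m \<nu> k" if u: "u \<in> carrier_vec k" "u \<noteq> 0\<^sub>v k" for k u
  proof -
    have "\<exists>i<l. y $ i \<noteq> 0" if "y \<in> carrier_vec l" "y \<noteq> 0\<^sub>v l" for l and y :: "complex vec"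
      using that eq_vecI[of y "0\<^sub>v l"] by auto
    then obtain i j where "i < \<nu>" "x $ i \<noteq> 0" "j < k" "u $ j \<noteq> 0" using x(1,2) u by meson
    then have "outer k u $$ (i,j) \<noteq> 0\<^sub>m \<nu> k $$ (i,j)" by (simp add: outer_def)
    then show ?thesis by metis
  qed
  let ?M = "outer n w" and ?G = "outer p (- v)"
  \<comment> \<open>The two null vector equations, solved for the terms in -v.\<close>
  have Cv: "(C\<^sup>T *\<^sub>v (- v)) $ j = (A\<^sup>T *\<^sub>v w) $ j - s * w $ j" if "j < n" for j
    using arg_cong[OF null1, of "\<lambda>u. u $ j"] that A C w v by (auto simp: add_eq_0_iff algebra_simps)
  have Dv: "(D\<^sup>T *\<^sub>v (- v)) $ j = (B\<^sup>T *\<^sub>v w) $ j" if "j < m" for j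
    using arg_cong[OF null2, of "\<lambda>u. u $ j"] that B D w v by (auto simp: add_eq_0_iff)
  have "?M * A - F * ?M = ?G * C"
  proof (rule eq_matI)
    fix i j assume "i < dim_row (?G * C)" "j < dim_col (?G * C)"
    then have ij: "i < \<nu>" "j < n" using C carr[of p "- v"] by auto
    have "(?M * A - F * ?M) $$ (i,j) = (?M * A) $$ (i,j) - (F * ?M) $$ (i,j)"
      using ij F A carr[of n w] by simp
    also have "\<dots> = x $ i * ((A\<^sup>T *\<^sub>v w) $ j - s * w $ j)"
      unfolding right[OF w A ij] left[OF w ij] by (simp add: right_diff_distrib)
    also have "\<dots> = x $ i * (C\<^sup>T *\<^sub>v (- v)) $ j" by (simp only: Cv[OF ij(2)])
    also have "\<dots> = (?G * C) $$ (i,j)" using right[OF _ C ij] v by simp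
    finally show "(?M * A - F * ?M) $$ (i,j) = (?G * C) $$ (i,j)" .
  qed (use A C F in \<open>auto simp: outer_def\<close>)
  moreover have "?M * B = ?G * D"
  proof (rule eq_matI)
    fix i j assume "i < dim_row (?G * D)" "j < dim_col (?G * D)"
    then have ij: "i < \<nu>" "j < m" using D carr[of p "- v"] by auto
    show "(?M * B) $$ (i,j) = (?G * D) $$ (i,j)"
      using right[OF w B ij] right[OF _ D ij] Dv[OF ij(2)] v by simp
  qed (use B D in \<open>auto simp: outer_def\<close>)
  moreover have "- v \<noteq> 0\<^sub>v p" if "v \<noteq> 0\<^sub>v p" using that v by (simp add: uminus_zero_vec_eq)
  with nz v have "?M \<noteq> 0\<^sub>m \<nu> n \<or> ?G \<noteq> 0\<^sub>m \<nu> p"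
    using outer_nz[OF w] outer_nz[of "- v" p] by auto
  ultimately show ?thesis
    by (intro bexI[OF _ carr[of n w]] bexI[OF _ carr[of p "- v"]] conjI)
qed

text \<open>Let Y = C X + D H with X F - A X = B H. Then tr (G Y) = tr ((M A - F M) X) + tr (M B H),
  and by \<open>mat_trace_sylvester\<close> the first term is -tr (M B H). By surjectivity every Y
  is of this form, so G = 0 by nondegeneracy.\<close>

lemma homogeneous_solution_zero_if_Cp_surj:
  assumes A: "A \<in> carrier_mat n n" and B: "B \<in> carrier_mat n m"
    and C: "C \<in> carrier_mat p n" and D: "D \<in> carrier_mat p m"
    and F: "F \<in> carrier_mat \<nu> \<nu>" and disj: "eig A \<inter> eig F = {}"
    and surj: "Cp A B C D F ` carrier_mat m \<nu> = carrier_mat p \<nu>"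
    and M: "M \<in> carrier_mat \<nu> n" and G: "G \<in> carrier_mat \<nu> p"
    and eq1: "M * A - F * M = G * C" and eq2: "M * B = G * D"
  shows "G = 0\<^sub>m \<nu> p"
proof (rule mat_eq_0_if_trace_mult_eq_0[OF G])
  fix Y :: "complex mat" assume "Y \<in> carrier_mat p \<nu>"
  then obtain H where H: "H \<in> carrier_mat m \<nu>" and Y: "Y = Cp A B C D F H" using surj by blast
  obtain X where X: "X \<in> carrier_mat n \<nu>" and XH: "X * F - A * X = B * H"
    using sylvester_solvable[OF A F disj mult_carrier_mat[OF B H]] by blast
  have "G * Y = G * C * X + G * D * H"
    unfolding Y Cp_eq[OF A F disj X XH] using G C X D H
    by (simp add: mult_add_distrib_mat[of _ \<nu> p _ \<nu>] assoc_mult_mat[of _ \<nu> p _ _ _ \<nu>])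
  moreover have "G * D * H = M * (B * H)" unfolding eq2[symmetric] by (rule assoc_mult_mat[OF M B H])
  ultimately have "mat_trace (G * Y) = mat_trace (G * C * X) + mat_trace (M * (B * H))"
    using G C X M B H by (simp add: mat_trace_add[of _ \<nu>])
  then show "mat_trace (G * Y) = 0"
    using mat_trace_sylvester[OF A F M X] by (simp add: eq1 XH)
qed

text \<open>This is injectivity of the linear map (M, G) -> (M A - F M - G C, G D - M B). It serves
  as the common intermediate condition in the equivalences.\<close>

definition dual_kernel_trivial ::
  "complex mat \<Rightarrow> complex mat \<Rightarrow> complex mat \<Rightarrow> complex mat \<Rightarrow> complex mat \<Rightarrow> bool" where
  "dual_kernel_trivial A B C D F \<longleftrightarrow>
    (\<forall>M\<in>carrier_mat (dim_row F) (dim_row A). \<forall>G\<in>carrier_mat (dim_row F) (dim_row C).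
      M * A - F * M = G * C \<and> M * B = G * D \<longrightarrow>
      M = 0\<^sub>m (dim_row F) (dim_row A) \<and> G = 0\<^sub>m (dim_row F) (dim_row C))"

lemma dual_kernel_trivialI:
  assumes "A \<in> carrier_mat n n" "C \<in> carrier_mat p n" "F \<in> carrier_mat \<nu> \<nu>"
    and "\<And>M G. M \<in> carrier_mat \<nu> n \<Longrightarrow> G \<in> carrier_mat \<nu> p \<Longrightarrow>
      M * A - F * M = G * C \<Longrightarrow> M * B = G * D \<Longrightarrow> M = 0\<^sub>m \<nu> n \<and> G = 0\<^sub>m \<nu> p"
  shows "dual_kernel_trivial A B C D F"
  using assms by (auto simp: dual_kernel_trivial_def)

lemma dual_kernel_trivialD:
  assumes "dual_kernel_trivial A B C D F"
    and "A \<in> carrier_mat n n" "C \<in> carrier_mat p n" "F \<in> carrier_mat \<nu> \<nu>"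
    and "M \<in> carrier_mat \<nu> n" "G \<in> carrier_mat \<nu> p"
    and "M * A - F * M = G * C" "M * B = G * D"
  shows "M = 0\<^sub>m \<nu> n" "G = 0\<^sub>m \<nu> p"
  using assms by (auto simp: dual_kernel_trivial_def)

lemma full_row_rank_if_dual_kernel_trivial:
  assumes A: "A \<in> carrier_mat n n" and B: "B \<in> carrier_mat n m"
    and C: "C \<in> carrier_mat p n" and D: "D \<in> carrier_mat p m"
    and F: "F \<in> carrier_mat \<nu> \<nu>"
    and triv: "dual_kernel_trivial A B C D F" and s: "s \<in> eig F"
  shows "full_row_rank (rosenbrock A B C D s)"
  using homogeneous_solution_if_rank_deficient[OF A B C D F s] dual_kernel_trivialD[OF triv A C F] by metis

text \<open>To reach Y, take P = 0 and Q = -Y. The first equation makes X the Sylvester solution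
  belonging to H, and the second then says that \<open>Cp\<close> maps H to Y.\<close>

lemma Cp_surj_if_solvable:
  assumes A: "A \<in> carrier_mat n n" and B: "B \<in> carrier_mat n m"
    and C: "C \<in> carrier_mat p n" and D: "D \<in> carrier_mat p m"
    and F: "F \<in> carrier_mat \<nu> \<nu>" and disj: "eig A \<inter> eig F = {}"
    and solvable: "\<And>P Q. P \<in> carrier_mat n \<nu> \<Longrightarrow> Q \<in> carrier_mat p \<nu> \<Longrightarrow>
      \<exists>X\<in>carrier_mat n \<nu>. \<exists>Y\<in>carrier_mat m \<nu>.
        X * F = A * X + B * Y + P \<and> 0\<^sub>m p \<nu> = C * X + D * Y + Q"
  shows "Cp A B C D F ` carrier_mat m \<nu> = carrier_mat p \<nu>"
proof (intro equalityI image_subsetI subsetI)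
  fix H :: "complex mat" assume H: "H \<in> carrier_mat m \<nu>"
  then obtain X where X: "X \<in> carrier_mat n \<nu>" and XH: "X * F - A * X = B * H"
    using sylvester_solvable[OF A F disj mult_carrier_mat[OF B H]] by blast
  show "Cp A B C D F H \<in> carrier_mat p \<nu>"
    unfolding Cp_eq[OF A F disj X XH] using C D X H by auto
next
  fix Y :: "complex mat" assume Y: "Y \<in> carrier_mat p \<nu>"
  obtain X H where X: "X \<in> carrier_mat n \<nu>" and H: "H \<in> carrier_mat m \<nu>"
    and 1: "X * F = A * X + B * H + 0\<^sub>m n \<nu>" and 2: "0\<^sub>m p \<nu> = C * X + D * H + (- Y)"
    using solvable[OF zero_carrier_mat uminus_carrier_mat[OF Y]] by blast
  have "X * F - A * X = B * H"
    unfolding 1 using A B X H by (intro eq_matI) auto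
  from Cp_eq[OF A F disj X this] have "Cp A B C D F H = C * X + D * H" .
  also have "\<dots> = C * X + D * H + (- Y) + Y"
    using C D X H Y by (intro eq_matI) auto
  also have "\<dots> = Y" unfolding 2[symmetric] using Y by simp
  finally show "Y \<in> Cp A B C D F ` carrier_mat m \<nu>" using H by blast
qed

text \<open>Trace duality gives G = 0. Then M solves the homogeneous Sylvester equation and vanishes
  by uniqueness.\<close>

lemma dual_kernel_trivial_if_Cp_surj:
  assumes A: "A \<in> carrier_mat n n" and B: "B \<in> carrier_mat n m"
    and C: "C \<in> carrier_mat p n" and D: "D \<in> carrier_mat p m"
    and F: "F \<in> carrier_mat \<nu> \<nu>" and disj: "eig A \<inter> eig F = {}"
    and surj: "Cp A B C D F ` carrier_mat m \<nu> = carrier_mat p \<nu>"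
  shows "dual_kernel_trivial A B C D F"
proof (rule dual_kernel_trivialI[OF A C F])
  fix M G assume M: "M \<in> carrier_mat \<nu> n" and G: "G \<in> carrier_mat \<nu> p"
    and eq: "M * A - F * M = G * C" "M * B = G * D"
  have G0: "G = 0\<^sub>m \<nu> p"
    using homogeneous_solution_zero_if_Cp_surj[OF A B C D F disj surj M G eq] .
  have "M = 0\<^sub>m \<nu> n"
    by (rule sylvester_unique[OF F A _ M zero_carrier_mat]) (use disj eq(1) A C F in \<open>auto simp: G0\<close>)
  with G0 show "M = 0\<^sub>m \<nu> n \<and> G = 0\<^sub>m \<nu> p" by blast
qed

text \<open>The data cancel in the difference of two solutions, which therefore lies in the dual
  kernel.\<close>

lemma dual_solution_unique:
  assumes A: "A \<in> carrier_mat n n" and B: "B \<in> carrier_mat n m"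
    and C: "C \<in> carrier_mat p n" and D: "D \<in> carrier_mat p m"
    and F: "F \<in> carrier_mat \<nu> \<nu>"
    and triv: "dual_kernel_trivial A B C D F"
    and carr: "Pb \<in> carrier_mat \<nu> n" "Qb \<in> carrier_mat \<nu> m" "M1 \<in> carrier_mat \<nu> n" "G1 \<in> carrier_mat \<nu> p"
      "M2 \<in> carrier_mat \<nu> n" "G2 \<in> carrier_mat \<nu> p"
    and 1: "M1 * A = F * M1 + G1 * C + Pb" "0\<^sub>m \<nu> m = - (M1 * B) + G1 * D + Qb"
    and 2: "M2 * A = F * M2 + G2 * C + Pb" "0\<^sub>m \<nu> m = - (M2 * B) + G2 * D + Qb"
  shows "M1 = M2 \<and> G1 = G2"
proof -
  have "(M1 - M2) * A - F * (M1 - M2) = M1 * A - M2 * A - (F * M1 - F * M2)"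
    using carr A F by (simp add: minus_mult_distrib_mat[of _ \<nu> n] mult_minus_distrib_mat[of _ \<nu> \<nu>])
  also have "\<dots> = G1 * C - G2 * C"
    unfolding 1(1) 2(1) using carr A F C by (intro eq_matI) auto
  also have "\<dots> = (G1 - G2) * C"
    using carr C by (simp add: minus_mult_distrib_mat[of _ \<nu> p])
  finally have eq1: "(M1 - M2) * A - F * (M1 - M2) = (G1 - G2) * C" .
  have "M1 * B - M2 * B = G1 * D - G2 * D"
  proof (rule eq_matI)
    fix i j assume "i < dim_row (G1 * D - G2 * D)" "j < dim_col (G1 * D - G2 * D)"
    then have ij: "i < \<nu>" "j < m" using carr D by auto
    show "(M1 * B - M2 * B) $$ (i,j) = (G1 * D - G2 * D) $$ (i,j)"
      using arg_cong[OF 1(2), of "\<lambda>N. N $$ (i,j)"] arg_cong[OF 2(2), of "\<lambda>N. N $$ (i,j)"]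
        ij carr B D by (simp add: algebra_simps del: index_mult_mat(1))
  qed (use carr B D in auto)
  then have "(M1 - M2) * B = (G1 - G2) * D"
    using carr B D by (simp add: minus_mult_distrib_mat[of _ \<nu> n] minus_mult_distrib_mat[of _ \<nu> p])
  from dual_kernel_trivialD[OF triv A C F minus_carrier_mat[OF carr(5)] minus_carrier_mat[OF carr(6)] eq1 this]
  show "M1 = M2 \<and> G1 = G2"
    using carr by (simp add: mat_minus_eq_0_iff)
qed

text \<open>The premise \<open>unique\<close> is statement (iii) at zero data with the zero pair as
  second solution. The equations for the zero pair are kept as premises so that (iii) can be
  instantiated directly.\<close>

lemma dual_kernel_trivial_if_unique:
  assumes A: "A \<in> carrier_mat n n" and B: "B \<in> carrier_mat n m"
    and C: "C \<in> carrier_mat p n" and D: "D \<in> carrier_mat p m"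
    and F: "F \<in> carrier_mat \<nu> \<nu>"
    and unique: "\<And>M G. M \<in> carrier_mat \<nu> n \<Longrightarrow> G \<in> carrier_mat \<nu> p \<Longrightarrow>
      M * A = F * M + G * C + 0\<^sub>m \<nu> n \<Longrightarrow> 0\<^sub>m \<nu> m = - (M * B) + G * D + 0\<^sub>m \<nu> m \<Longrightarrow>
      0\<^sub>m \<nu> n * A = F * 0\<^sub>m \<nu> n + 0\<^sub>m \<nu> p * C + 0\<^sub>m \<nu> n \<Longrightarrow>
      0\<^sub>m \<nu> m = - (0\<^sub>m \<nu> n * B) + 0\<^sub>m \<nu> p * D + 0\<^sub>m \<nu> m \<Longrightarrow>
      M = 0\<^sub>m \<nu> n \<and> G = 0\<^sub>m \<nu> p"
  shows "dual_kernel_trivial A B C D F"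
proof (rule dual_kernel_trivialI[OF A C F])
  fix M G assume M: "M \<in> carrier_mat \<nu> n" and G: "G \<in> carrier_mat \<nu> p"
    and eq: "M * A - F * M = G * C" "M * B = G * D"
  have "M * A = F * M + G * C + 0\<^sub>m \<nu> n"
    unfolding eq(1)[symmetric] using M A F by (intro eq_matI) auto
  moreover have "0\<^sub>m \<nu> m = - (M * B) + G * D + 0\<^sub>m \<nu> m"
    unfolding eq(2) using G D by (intro eq_matI) auto
  moreover have "0\<^sub>m \<nu> n * A = F * 0\<^sub>m \<nu> n + 0\<^sub>m \<nu> p * C + 0\<^sub>m \<nu> n" using A C F by simp
  moreover have "0\<^sub>m \<nu> m = - (0\<^sub>m \<nu> n * B) + 0\<^sub>m \<nu> p * D + 0\<^sub>m \<nu> m"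
    using B D by (intro eq_matI) auto
  ultimately show "M = 0\<^sub>m \<nu> n \<and> G = 0\<^sub>m \<nu> p"
    by (rule unique[OF M G])
qed

lemma inj_Cd_if_dual_kernel_trivial:
  assumes A: "A \<in> carrier_mat n n" and B: "B \<in> carrier_mat n m"
    and C: "C \<in> carrier_mat p n" and D: "D \<in> carrier_mat p m"
    and F: "F \<in> carrier_mat \<nu> \<nu>" and disj: "eig A \<inter> eig F = {}"
    and triv: "dual_kernel_trivial A B C D F"
  shows "inj_on (Cd A B C D F) (carrier_mat \<nu> p)"
proof (rule inj_onI)
  fix G1 G2 assume G: "G1 \<in> carrier_mat \<nu> p" "G2 \<in> carrier_mat \<nu> p"
    and eq: "Cd A B C D F G1 = Cd A B C D F G2"
  obtain M1 where M1: "M1 \<in> carrier_mat \<nu> n" "M1 * A - F * M1 = G1 * C"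
    using sylvester_solvable[OF F A _ mult_carrier_mat[OF G(1) C]] disj by blast
  obtain M2 where M2: "M2 \<in> carrier_mat \<nu> n" "M2 * A - F * M2 = G2 * C"
    using sylvester_solvable[OF F A _ mult_carrier_mat[OF G(2) C]] disj by blast
  note eq' = eq[unfolded Cd_eq[OF A F disj M1] Cd_eq[OF A F disj M2]]
  \<comment> \<open>With this choice (M1, G1) solves the dual system with first datum 0. Equality of
    the two \<open>Cd\<close> values makes (M2, G2) solve the same system.\<close>
  define Qb where "Qb = - (- (M1 * B) + G1 * D)"
  have Qb: "Qb \<in> carrier_mat \<nu> m" using M1 B G D by (simp add: Qb_def)
  have "M1 * A = F * M1 + G1 * C + 0\<^sub>m \<nu> n"
    unfolding M1(2)[symmetric] using M1(1) A F by (intro eq_matI) auto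
  moreover have 1: "0\<^sub>m \<nu> m = - (M1 * B) + G1 * D + Qb"
    unfolding Qb_def using M1(1) B D G by (intro eq_matI) auto
  moreover have "M2 * A = F * M2 + G2 * C + 0\<^sub>m \<nu> n"
    unfolding M2(2)[symmetric] using M2(1) A F by (intro eq_matI) auto
  moreover have "0\<^sub>m \<nu> m = - (M2 * B) + G2 * D + Qb" using 1 unfolding eq' .
  ultimately show "G1 = G2"
    by (rule conjunct2[OF dual_solution_unique[OF A B C D F triv zero_carrier_mat Qb M1(1) G(1) M2(1) G(2)]])
qed

text \<open>For a pair in the dual kernel, M B = G D says that \<open>Cd\<close> takes the same
  value at G and at 0, so G = 0. Uniqueness for the Sylvester equation then gives M = 0.\<close>

lemma dual_kernel_trivial_if_inj_Cd:
  assumes A: "A \<in> carrier_mat n n" and B: "B \<in> carrier_mat n m"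
    and C: "C \<in> carrier_mat p n" and D: "D \<in> carrier_mat p m"
    and F: "F \<in> carrier_mat \<nu> \<nu>" and disj: "eig A \<inter> eig F = {}"
    and inj: "inj_on (Cd A B C D F) (carrier_mat \<nu> p)"
  shows "dual_kernel_trivial A B C D F"
proof (rule dual_kernel_trivialI[OF A C F])
  fix M G assume M: "M \<in> carrier_mat \<nu> n" and G: "G \<in> carrier_mat \<nu> p"
    and eq: "M * A - F * M = G * C" "M * B = G * D"
  have zero: "0\<^sub>m \<nu> n * A - F * 0\<^sub>m \<nu> n = 0\<^sub>m \<nu> p * C" using A C F by simp
  have "- (M * B) + G * D = - (0\<^sub>m \<nu> n * B) + 0\<^sub>m \<nu> p * D"
    unfolding eq(2) using B D G by (intro eq_matI) auto
  then have "Cd A B C D F G = Cd A B C D F (0\<^sub>m \<nu> p)"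
    using Cd_eq[OF A F disj M eq(1)] Cd_eq[OF A F disj zero_carrier_mat zero] by metis
  then have G0: "G = 0\<^sub>m \<nu> p" using inj G by (auto dest: inj_onD)
  have "M = 0\<^sub>m \<nu> n"
    by (rule sylvester_unique[OF F A _ M zero_carrier_mat]) (use disj eq(1) zero in \<open>auto simp: G0\<close>)
  with G0 show "M = 0\<^sub>m \<nu> n \<and> G = 0\<^sub>m \<nu> p" by blast
qed

section \<open>Assembly of the equivalences and the controllability statements\<close>

theorem theorem1:
  fixes n m p \<nu> :: nat and A B C D F :: "complex mat"
  assumes A: "A \<in> carrier_mat n n" and B: "B \<in> carrier_mat n m"
    and C: "C \<in> carrier_mat p n" and D: "D \<in> carrier_mat p m"
    and F: "F \<in> carrier_mat \<nu> \<nu>"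
    and disj: "eig A \<inter> eig F = {}"
  shows
   "((\<forall>s \<in> eig F. full_row_rank (rosenbrock A B C D s))
      \<longleftrightarrow> (\<forall>P \<in> carrier_mat n \<nu>. \<forall>Q \<in> carrier_mat p \<nu>.
             \<exists>PI \<in> carrier_mat n \<nu>. \<exists>PSI \<in> carrier_mat m \<nu>.
               PI * F = A * PI + B * PSI + P \<and> 0\<^sub>m p \<nu> = C * PI + D * PSI + Q))
    \<and> ((\<forall>s \<in> eig F. full_row_rank (rosenbrock A B C D s))
      \<longleftrightarrow> (\<forall>Pb \<in> carrier_mat \<nu> n. \<forall>Qb \<in> carrier_mat \<nu> m.
             \<forall>M1 \<in> carrier_mat \<nu> n. \<forall>G1 \<in> carrier_mat \<nu> p.
             \<forall>M2 \<in> carrier_mat \<nu> n. \<forall>G2 \<in> carrier_mat \<nu> p.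
               (M1 * A = F * M1 + G1 * C + Pb \<and> 0\<^sub>m \<nu> m = - (M1 * B) + G1 * D + Qb)
             \<and> (M2 * A = F * M2 + G2 * C + Pb \<and> 0\<^sub>m \<nu> m = - (M2 * B) + G2 * D + Qb)
             \<longrightarrow> M1 = M2 \<and> G1 = G2))
    \<and> ((\<forall>s \<in> eig F. full_row_rank (rosenbrock A B C D s))
      \<longleftrightarrow> Cp A B C D F ` carrier_mat m \<nu> = carrier_mat p \<nu>)
    \<and> ((\<forall>s \<in> eig F. full_row_rank (rosenbrock A B C D s))
      \<longleftrightarrow> inj_on (Cd A B C D F) (carrier_mat \<nu> p))
    \<and> (\<forall>G \<in> carrier_mat \<nu> p.
         (controllable F G \<and> (\<forall>s \<in> eig F. full_row_rank (rosenbrock A B C D s))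
            \<longrightarrow> controllable F (Cd A B C D F G))
       \<and> (stabilizable F G \<and> (\<forall>s \<in> eig F. Re s \<ge> 0 \<longrightarrow> full_row_rank (rosenbrock A B C D s))
            \<longrightarrow> stabilizable F (Cd A B C D F G))
       \<and> ((\<forall>s \<in> eig F. (\<lambda>x. transpose_mat G *\<^sub>v x) ` mat_kernel (s \<cdot>\<^sub>m 1\<^sub>m \<nu> - transpose_mat F) = carrier_vec p)
            \<longrightarrow> controllable F (Cd A B C D F G)
            \<longrightarrow> controllable F G \<and> (\<forall>s \<in> eig F. full_row_rank (rosenbrock A B C D s)))
       \<and> ((\<forall>s \<in> eig F. Re s \<ge> 0 \<longrightarrow> (\<lambda>x. transpose_mat G *\<^sub>v x) ` mat_kernel (s \<cdot>\<^sub>m 1\<^sub>m \<nu> - transpose_mat F) = carrier_vec p)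
            \<longrightarrow> stabilizable F (Cd A B C D F G)
            \<longrightarrow> stabilizable F G \<and> (\<forall>s \<in> eig F. Re s \<ge> 0 \<longrightarrow> full_row_rank (rosenbrock A B C D s))))"
proof -
  let ?full = "\<forall>s \<in> eig F. full_row_rank (rosenbrock A B C D s)"
  let ?triv = "dual_kernel_trivial A B C D F"
  let ?surj = "Cp A B C D F ` carrier_mat m \<nu> = carrier_mat p \<nu>"
  let ?inj = "inj_on (Cd A B C D F) (carrier_mat \<nu> p)"
  let ?solvable = "\<forall>P \<in> carrier_mat n \<nu>. \<forall>Q \<in> carrier_mat p \<nu>.
    \<exists>PI \<in> carrier_mat n \<nu>. \<exists>PSI \<in> carrier_mat m \<nu>.
      PI * F = A * PI + B * PSI + P \<and> 0\<^sub>m p \<nu> = C * PI + D * PSI + Q"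
  let ?unique = "\<forall>Pb \<in> carrier_mat \<nu> n. \<forall>Qb \<in> carrier_mat \<nu> m.
    \<forall>M1 \<in> carrier_mat \<nu> n. \<forall>G1 \<in> carrier_mat \<nu> p.
    \<forall>M2 \<in> carrier_mat \<nu> n. \<forall>G2 \<in> carrier_mat \<nu> p.
      (M1 * A = F * M1 + G1 * C + Pb \<and> 0\<^sub>m \<nu> m = - (M1 * B) + G1 * D + Qb)
    \<and> (M2 * A = F * M2 + G2 * C + Pb \<and> 0\<^sub>m \<nu> m = - (M2 * B) + G2 * D + Qb)
    \<longrightarrow> M1 = M2 \<and> G1 = G2"

  \<comment> \<open>The implications form a cycle from (i) through (ii), (iv) and triviality of the
    dual kernel back to (i). Statements (iii) and (v) are each equivalent to that
    triviality.\<close>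
  have full_solvable: "?full \<Longrightarrow> ?solvable"
    by (intro ballI regulator_equation_solvable[OF A B C D F]) simp_all
  have solvable_surj: "?solvable \<Longrightarrow> ?surj"
    by (rule Cp_surj_if_solvable[OF A B C D F disj]) simp
  have surj_triv: "?surj \<Longrightarrow> ?triv"
    by (rule dual_kernel_trivial_if_Cp_surj[OF A B C D F disj])
  have triv_full: "?triv \<Longrightarrow> ?full"
    using full_row_rank_if_dual_kernel_trivial[OF A B C D F] by blast
  have triv_unique: "?triv \<Longrightarrow> ?unique"
    by (intro ballI impI, elim conjE) (rule dual_solution_unique[OF A B C D F])
  have unique_triv: "?triv" if ?unique
    by (rule dual_kernel_trivial_if_unique[OF A B C D F])
      (rule that[rule_format, OF zero_carrier_mat zero_carrier_mat _ _ zero_carrier_mat zero_carrier_mat];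
        (assumption | intro conjI))
  have triv_inj: "?triv \<Longrightarrow> ?inj"
    by (rule inj_Cd_if_dual_kernel_trivial[OF A B C D F disj])
  have inj_triv: "?inj \<Longrightarrow> ?triv"
    by (rule dual_kernel_trivial_if_inj_Cd[OF A B C D F disj])
  have full_triv: "?full \<Longrightarrow> ?triv"
    by (rule surj_triv, rule solvable_surj, rule full_solvable)

  have dims: "dim_row F = \<nu>" "dim_col G = p" "dim_col (Cd A B C D F G) = m" if "G \<in> carrier_mat \<nu> p" for G
    using that F Cd_carrier[OF A C D F disj that] by auto
  note forward = full_rank_imp_Cd_eigenvector[OF A B C D F disj]
  note backward = Cd_eigenvector_imp[OF A B C D F disj]
  note rank = full_rank_if_Cd_eigenvector[OF A B C D F disj]
  have notA: "s \<notin> eig A" if "s \<in> eig F" for s using that disj by blast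
  show ?thesis
  proof (intro conjI ballI)
    show "?full \<longleftrightarrow> ?solvable" by (rule iffI[OF full_solvable triv_full[OF surj_triv[OF solvable_surj]]])
    show "?full \<longleftrightarrow> ?unique" by (rule iffI[OF triv_unique[OF full_triv] triv_full[OF unique_triv]])
    show "?full \<longleftrightarrow> ?surj" by (rule iffI[OF solvable_surj[OF full_solvable] triv_full[OF surj_triv]])
    show "?full \<longleftrightarrow> ?inj" by (rule iffI[OF triv_inj[OF full_triv] triv_full[OF inj_triv]])
    fix G :: "complex mat" assume G: "G \<in> carrier_mat \<nu> p"
    \<comment> \<open>Stated at a single s, this yields (a) by quantifying over all eigenvalues of F
      and (b) by quantifying over those with nonnegative real part.\<close>
    have forward': "\<forall>\<phi>\<in>carrier_vec \<nu>. \<phi> \<noteq> 0\<^sub>v \<nu> \<and> F\<^sup>T *\<^sub>v \<phi> = s \<cdot>\<^sub>v \<phi> \<longrightarrow> (Cd A B C D F G)\<^sup>T *\<^sub>v \<phi> \<noteq> 0\<^sub>v m"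
      if ctrl: "\<forall>\<phi>\<in>carrier_vec \<nu>. \<phi> \<noteq> 0\<^sub>v \<nu> \<and> F\<^sup>T *\<^sub>v \<phi> = s \<cdot>\<^sub>v \<phi> \<longrightarrow> G\<^sup>T *\<^sub>v \<phi> \<noteq> 0\<^sub>v p"
        and full: "full_row_rank (rosenbrock A B C D s)" for s
    proof (intro ballI impI notI, elim conjE)
      fix \<phi> assume \<phi>: "\<phi> \<in> carrier_vec \<nu>" "\<phi> \<noteq> 0\<^sub>v \<nu>" "F\<^sup>T *\<^sub>v \<phi> = s \<cdot>\<^sub>v \<phi>"
        and zero: "(Cd A B C D F G)\<^sup>T *\<^sub>v \<phi> = 0\<^sub>v m"
      from forward[OF G full \<phi>(1,3) zero] ctrl \<phi> show False by simp
    qed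
    \<comment> \<open>The pointwise form of both converses, likewise restricted to one eigenvalue
      s.\<close>
    have converse: "\<forall>\<phi>\<in>carrier_vec \<nu>. \<phi> \<noteq> 0\<^sub>v \<nu> \<and> F\<^sup>T *\<^sub>v \<phi> = s \<cdot>\<^sub>v \<phi> \<longrightarrow> G\<^sup>T *\<^sub>v \<phi> \<noteq> 0\<^sub>v p"
        "full_row_rank (rosenbrock A B C D s)"
      if s: "s \<in> eig F"
        and onto: "(\<lambda>x. G\<^sup>T *\<^sub>v x) ` mat_kernel (s \<cdot>\<^sub>m 1\<^sub>m \<nu> - F\<^sup>T) = carrier_vec p"
        and ctrl: "\<forall>\<phi>\<in>carrier_vec \<nu>. \<phi> \<noteq> 0\<^sub>v \<nu> \<and> F\<^sup>T *\<^sub>v \<phi> = s \<cdot>\<^sub>v \<phi> \<longrightarrow>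
          (Cd A B C D F G)\<^sup>T *\<^sub>v \<phi> \<noteq> 0\<^sub>v m" for s
    proof -
      show "\<forall>\<phi>\<in>carrier_vec \<nu>. \<phi> \<noteq> 0\<^sub>v \<nu> \<and> F\<^sup>T *\<^sub>v \<phi> = s \<cdot>\<^sub>v \<phi> \<longrightarrow> G\<^sup>T *\<^sub>v \<phi> \<noteq> 0\<^sub>v p"
      proof (intro ballI impI notI, elim conjE)
        fix \<phi> assume \<phi>: "\<phi> \<in> carrier_vec \<nu>" "\<phi> \<noteq> 0\<^sub>v \<nu>" "F\<^sup>T *\<^sub>v \<phi> = s \<cdot>\<^sub>v \<phi>" and zero: "G\<^sup>T *\<^sub>v \<phi> = 0\<^sub>v p"
        show False using backward[OF G notA[OF s] \<phi>(1,3) zero] ctrl \<phi> by simp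
      qed
      show "full_row_rank (rosenbrock A B C D s)"
      proof (rule rank[OF G notA[OF s] onto], rule ccontr)
        fix \<phi> assume "\<phi> \<in> carrier_vec \<nu>" "F\<^sup>T *\<^sub>v \<phi> = s \<cdot>\<^sub>v \<phi>" "\<phi> \<noteq> 0\<^sub>v \<nu>" "(Cd A B C D F G)\<^sup>T *\<^sub>v \<phi> = 0\<^sub>v m"
        with ctrl show False by simp
      qed
    qed
    show "controllable F G \<and> (\<forall>s \<in> eig F. full_row_rank (rosenbrock A B C D s))
        \<longrightarrow> controllable F (Cd A B C D F G)"
    proof (intro impI, elim conjE)
      assume "controllable F G" and full: "\<forall>s \<in> eig F. full_row_rank (rosenbrock A B C D s)"
      note ctrl = this(1)[unfolded controllable_def dims[OF G]]
      show "controllable F (Cd A B C D F G)"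
        unfolding controllable_def dims[OF G]
        by (rule ballI, rule forward') (rule bspec[OF ctrl] bspec[OF full]; assumption)+
    qed
    show "stabilizable F G \<and> (\<forall>s \<in> eig F. Re s \<ge> 0 \<longrightarrow> full_row_rank (rosenbrock A B C D s))
        \<longrightarrow> stabilizable F (Cd A B C D F G)"
    proof (intro impI, elim conjE)
      assume "stabilizable F G" and full: "\<forall>s \<in> eig F. 0 \<le> Re s \<longrightarrow> full_row_rank (rosenbrock A B C D s)"
      note ctrl = this(1)[unfolded stabilizable_def dims[OF G]]
      show "stabilizable F (Cd A B C D F G)"
        unfolding stabilizable_def dims[OF G]
        by (rule ballI, rule impI, rule forward')
          (rule mp[OF bspec[OF ctrl]] mp[OF bspec[OF full]]; assumption)+
    qed
    show "(\<forall>s \<in> eig F. (\<lambda>x. transpose_mat G *\<^sub>v x) ` mat_kernel (s \<cdot>\<^sub>m 1\<^sub>m \<nu> - transpose_mat F) = carrier_vec p)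
        \<longrightarrow> controllable F (Cd A B C D F G)
        \<longrightarrow> controllable F G \<and> (\<forall>s \<in> eig F. full_row_rank (rosenbrock A B C D s))"
    proof (intro impI)
      assume onto: "\<forall>s \<in> eig F. (\<lambda>x. transpose_mat G *\<^sub>v x) ` mat_kernel (s \<cdot>\<^sub>m 1\<^sub>m \<nu> - transpose_mat F) = carrier_vec p"
        and "controllable F (Cd A B C D F G)"
      note ctrl = this(2)[unfolded controllable_def dims[OF G]]
      have at: "\<forall>\<phi>\<in>carrier_vec \<nu>. \<phi> \<noteq> 0\<^sub>v \<nu> \<and> F\<^sup>T *\<^sub>v \<phi> = s \<cdot>\<^sub>v \<phi> \<longrightarrow> G\<^sup>T *\<^sub>v \<phi> \<noteq> 0\<^sub>v p"
          "full_row_rank (rosenbrock A B C D s)" if s: "s \<in> eig F" for s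
        by (fact converse[OF s bspec[OF onto s] bspec[OF ctrl s]])+
      show "controllable F G \<and> (\<forall>s \<in> eig F. full_row_rank (rosenbrock A B C D s))"
        unfolding controllable_def dims[OF G]
        by (rule conjI; rule ballI; rule at; assumption)
    qed
    show "(\<forall>s \<in> eig F. Re s \<ge> 0 \<longrightarrow> (\<lambda>x. transpose_mat G *\<^sub>v x) ` mat_kernel (s \<cdot>\<^sub>m 1\<^sub>m \<nu> - transpose_mat F) = carrier_vec p)
        \<longrightarrow> stabilizable F (Cd A B C D F G)
        \<longrightarrow> stabilizable F G \<and> (\<forall>s \<in> eig F. Re s \<ge> 0 \<longrightarrow> full_row_rank (rosenbrock A B C D s))"
    proof (intro impI)
      assume onto: "\<forall>s \<in> eig F. 0 \<le> Re s \<longrightarrow> (\<lambda>x. transpose_mat G *\<^sub>v x) ` mat_kernel (s \<cdot>\<^sub>m 1\<^sub>m \<nu> - transpose_mat F) = carrier_vec p"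
        and "stabilizable F (Cd A B C D F G)"
      note ctrl = this(2)[unfolded stabilizable_def dims[OF G]]
      have at: "\<forall>\<phi>\<in>carrier_vec \<nu>. \<phi> \<noteq> 0\<^sub>v \<nu> \<and> F\<^sup>T *\<^sub>v \<phi> = s \<cdot>\<^sub>v \<phi> \<longrightarrow> G\<^sup>T *\<^sub>v \<phi> \<noteq> 0\<^sub>v p"
          "full_row_rank (rosenbrock A B C D s)" if s: "s \<in> eig F" "0 \<le> Re s" for s
        by (fact converse[OF s(1) mp[OF bspec[OF onto s(1)] s(2)] mp[OF bspec[OF ctrl s(1)] s(2)]])+
      show "stabilizable F G \<and> (\<forall>s \<in> eig F. 0 \<le> Re s \<longrightarrow> full_row_rank (rosenbrock A B C D s))"
        unfolding stabilizable_def dims[OF G]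
        by (rule conjI; rule ballI; rule impI; rule at; assumption)
    qed
  qed
qed

end
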